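(* For infinite weighted graphs $\Gamma$, the property $\bar h(\Gamma)<1$, which is equivalent to the property $\bar\lambda(\Gamma)<2$, is not a rough-isometric invariant. That is: for every infinite graph $\Gamma$, $\bar h(\Gamma)<1$ if and only if $\bar\lambda(\Gamma)<2$, and there exist infinite graphs $\Gamma$ and $\Gamma'$ which are rough-isometric to each other (with respect to their graph distances) such that $\bar h(\Gamma)<1$ but $\bar h(\Gamma')=1$.
   Context: An infinite graph $\Gamma=(V,E)$ here means a locally finite, connected graph with infinitely many vertices, equipped with symmetric edge weights $\mu_{xy}=\mu_{yx}\ge 0$, where $\mu_{xy}>0$ iff $(x,y)\in E$; self-loops are allowed. Put $\mu(x)=\sum_{y\in V}\mu_{xy}$, $\mathrm{vol}(U)=\sum_{x\in U}\mu(x)$ and $|E(V_1,V_2)|=\sum_{x\in V_1}\sum_{y\in V_2}\mu_{xy}$ for finite $U,V_1,V_2\subset V$. The dual Cheeger constant is $\bar h(\Gamma)=\sup\left\{\frac{2|E(V_1,V_2)|}{\mathrm{vol}(V_1)+\mathrm{vol}(V_2)}\right\}$ over pairs of disjoint nonempty finite subsets $V_1,V_2\subset V$. The normalized Laplace operator is the bounded self-adjoint operator on $\ell^2(V,\mu)$ given by $\Delta f(x)=f(x)-\frac1{\mu(x)}\sum_{y}\mu_{xy}f(y)$, and $\bar\lambda(\Gamma)=\sup\sigma(\Delta)$ (always $\le2$). A rough isometry between metric spaces $(X,d^X)$, $(Y,d^Y)$ is a map $\phi:X\to Y$ for which there are $a\ge1$, $b\ge0$ with $a^{-1}d^X(x,y)-b\le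 d^Y(\phi(x),\phi(y))\le a\,d^X(x,y)+b$ for all $x,y\in X$ and $\inf_{x\in X}d^Y(z,\phi(x))\le b$ for all $z\in Y$. Two graphs are rough-isometric if there is a rough isometry between their vertex sets with the graph distances. *)

theory Defs
  imports "HOL-Analysis.Analysis"
begin

locale infinite_graph =
  fixes V :: "'a set" and E :: "('a \<times> 'a) set" and \<mu> :: "'a \<Rightarrow> 'a \<Rightarrow> real"
  assumes edges_subset: "E \<subseteq> V \<times> V"
    and weight_sym: "\<And>x y. x \<in> V \<Longrightarrow> y \<in> V \<Longrightarrow> \<mu> x y = \<mu> y x"
    and weight_nonneg: "\<And>x y. x \<in> V \<Longrightarrow> y \<in> V \<Longrightarrow> 0 \<le> \<mu> x y"
    and weight_pos_iff: "\<And>x y. x \<in> V \<Longrightarrow> y \<in> V \<Longrightarrow> 0 < \<mu> x y \<longleftrightarrow> (x, y) \<in> E"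
    and locally_finite: "\<And>x. x \<in> V \<Longrightarrow> finite {y. (x, y) \<in> E}"
    and connected_graph: "\<And>x y. x \<in> V \<Longrightarrow> y \<in> V \<Longrightarrow> (x, y) \<in> E\<^sup>*"
    and infinite_vertices: "infinite V"

(* V is infinite, so the sum over V has to be infsum: a plain sum over an
   infinite index set is 0 by convention.  By local finiteness only finitely
   many terms are nonzero. *)
definition vertex_weight :: "'a set \<Rightarrow> ('a \<Rightarrow> 'a \<Rightarrow> real) \<Rightarrow> 'a \<Rightarrow> real" where
  "vertex_weight V \<mu> x = (\<Sum>\<^sub>\<infinity>y\<in>V. \<mu> x y)"

definition vol :: "'a set \<Rightarrow> ('a \<Rightarrow> 'a \<Rightarrow> real) \<Rightarrow> 'a set \<Rightarrow> real" where
  "vol V \<mu> U = (\<Sum>x\<in>U. vertex_weight V \<mu> x)"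

definition edge_weight :: "('a \<Rightarrow> 'a \<Rightarrow> real) \<Rightarrow> 'a set \<Rightarrow> 'a set \<Rightarrow> real" where
  "edge_weight \<mu> V1 V2 = (\<Sum>x\<in>V1. \<Sum>y\<in>V2. \<mu> x y)"

definition dual_cheeger :: "'a set \<Rightarrow> ('a \<Rightarrow> 'a \<Rightarrow> real) \<Rightarrow> real" where
  "dual_cheeger V \<mu> =
     Sup {2 * edge_weight \<mu> V1 V2 / (vol V \<mu> V1 + vol V \<mu> V2) | V1 V2.
            V1 \<subseteq> V \<and> V2 \<subseteq> V \<and> finite V1 \<and> finite V2 \<and>
            V1 \<noteq> {} \<and> V2 \<noteq> {} \<and> V1 \<inter> V2 = {}}"

(* A function on V is represented by its extension by 0 to the whole type, so
   that equality of functions on V is equality in HOL. *)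
definition l2 :: "'a set \<Rightarrow> ('a \<Rightarrow> 'a \<Rightarrow> real) \<Rightarrow> ('a \<Rightarrow> complex) set" where
  "l2 V \<mu> = {f. (\<forall>x. x \<notin> V \<longrightarrow> f x = 0) \<and>
                 (\<lambda>x. vertex_weight V \<mu> x * (cmod (f x))\<^sup>2) summable_on V}"

definition l2_norm :: "'a set \<Rightarrow> ('a \<Rightarrow> 'a \<Rightarrow> real) \<Rightarrow> ('a \<Rightarrow> complex) \<Rightarrow> real" where
  "l2_norm V \<mu> f = sqrt (\<Sum>\<^sub>\<infinity>x\<in>V. vertex_weight V \<mu> x * (cmod (f x))\<^sup>2)"

definition bounded_l2_operator ::
    "'a set \<Rightarrow> ('a \<Rightarrow> 'a \<Rightarrow> real) \<Rightarrow> (('a \<Rightarrow> complex) \<Rightarrow> ('a \<Rightarrow> complex)) \<Rightarrow> bool" where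
  "bounded_l2_operator V \<mu> T \<longleftrightarrow>
     (\<forall>f\<in>l2 V \<mu>. T f \<in> l2 V \<mu>) \<and>
     (\<forall>f\<in>l2 V \<mu>. \<forall>g\<in>l2 V \<mu>. T (\<lambda>x. f x + g x) = (\<lambda>x. T f x + T g x)) \<and>
     (\<forall>c. \<forall>f\<in>l2 V \<mu>. T (\<lambda>x. c * f x) = (\<lambda>x. c * T f x)) \<and>
     (\<exists>C. \<forall>f\<in>l2 V \<mu>. l2_norm V \<mu> (T f) \<le> C * l2_norm V \<mu> f)"

(* The complex numbers z for which T - z has no bounded two-sided inverse. *)
definition l2_spectrum ::
    "'a set \<Rightarrow> ('a \<Rightarrow> 'a \<Rightarrow> real) \<Rightarrow> (('a \<Rightarrow> complex) \<Rightarrow> ('a \<Rightarrow> complex)) \<Rightarrow> complex set" where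
  "l2_spectrum V \<mu> T =
     {z. \<not> (\<exists>S. bounded_l2_operator V \<mu> S \<and>
               (\<forall>f\<in>l2 V \<mu>. S (\<lambda>x. T f x - z * f x) = f \<and>
                            (\<lambda>x. T (S f) x - z * S f x) = f))}"

definition laplacian :: "'a set \<Rightarrow> ('a \<Rightarrow> 'a \<Rightarrow> real) \<Rightarrow> ('a \<Rightarrow> complex) \<Rightarrow> ('a \<Rightarrow> complex)" where
  "laplacian V \<mu> f = (\<lambda>x. if x \<in> V
     then f x - (\<Sum>\<^sub>\<infinity>y\<in>V. complex_of_real (\<mu> x y) * f y) / complex_of_real (vertex_weight V \<mu> x)
     else 0)"

(* The Laplacian is self-adjoint, so its spectrum lies on the real axis; the
   supremum is taken over the spectrum read as a set of reals. *)
definition lambda_bar :: "'a set \<Rightarrow> ('a \<Rightarrow> 'a \<Rightarrow> real) \<Rightarrow> real" where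
  "lambda_bar V \<mu> = Sup {t. complex_of_real t \<in> l2_spectrum V \<mu> (laplacian V \<mu>)}"

definition graph_dist :: "('a \<times> 'a) set \<Rightarrow> 'a \<Rightarrow> 'a \<Rightarrow> real" where
  "graph_dist E x y = real (LEAST n. (x, y) \<in> E ^^ n)"

definition rough_isometry ::
    "'a set \<Rightarrow> ('a \<Rightarrow> 'a \<Rightarrow> real) \<Rightarrow> 'b set \<Rightarrow> ('b \<Rightarrow> 'b \<Rightarrow> real) \<Rightarrow> ('a \<Rightarrow> 'b) \<Rightarrow> bool" where
  "rough_isometry X dX Y dY \<phi> \<longleftrightarrow>
     (\<forall>x\<in>X. \<phi> x \<in> Y) \<and>
     (\<exists>a b. 1 \<le> a \<and> 0 \<le> b \<and>
        (\<forall>x\<in>X. \<forall>y\<in>X. inverse a * dX x y - b \<le> dY (\<phi> x) (\<phi> y) \<and>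
                        dY (\<phi> x) (\<phi> y) \<le> a * dX x y + b) \<and>
        (\<forall>z\<in>Y. (INF x\<in>X. dY z (\<phi> x)) \<le> b))"

definition rough_isometric_graphs ::
    "'a set \<Rightarrow> ('a \<times> 'a) set \<Rightarrow> 'b set \<Rightarrow> ('b \<times> 'b) set \<Rightarrow> bool" where
  "rough_isometric_graphs V E V' E' \<longleftrightarrow>
     (\<exists>\<phi>. rough_isometry V (graph_dist E) V' (graph_dist E') \<phi>)"

end

theory Submission
  imports Defs
begin

text \<open>
  Write P for the random walk operator, so that the Laplacian is 1 - P. Both constants are governed
  by the signless form q(f) = \<langle>f, f + P f\<rangle>, which equals half the sum of
  \<mu>(x,y) (f(x) + f(y))^2 over ordered pairs. Let m be the largest constant with
  q(f) \<ge> m |f|^2 for all finitely supported real f.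

  First, 2 - m is the supremum of the spectrum (lemma \<open>lambda_bar_eq\<close>). It lies in the
  spectrum because B = 1 + P - m is a nonnegative form, and for those Cauchy-Schwarz bounds
  |B f|^2 by a multiple of \<langle>f, B f\<rangle>; a bounded inverse of B would then keep
  \<langle>f, B f\<rangle> / |f|^2 away from 0, and m could be increased. Nothing larger is in the spectrum:
  for t > 2 - m the operator t - 1 + P is bounded below by a positive constant, so that
  u \<mapsto> u - \<alpha> (t - 1 + P) u is a strict contraction for small \<alpha>, and a Neumann series
  provides the inverse. Since P only sees neighbours, all estimates reduce to finite sums, and the
  series can be summed vertex by vertex.

  Second, m is positive exactly when the dual Cheeger constant h is below 1. Testing q on the
  function that is 1 on one set and -1 on the other gives h \<le> 1 - m/2. Conversely one cuts f at
  the levels {f^2 > \<tau>}, separates each level set by the sign of f, applies the definition of h to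
  the two halves and integrates over \<tau>; comparing the integrated inequality with q gives
  m \<ge> (1 - h)^2 / 2.

  Rough isometries do not see self-loops, because a loop never shortens a path. But h does: the half
  line is bipartite with slowly growing volume, so h = 1, whereas a loop of weight 1 at every vertex
  takes up at least a third of the volume of each finite set and pushes h down to at most 2/3.
\<close>

section \<open>The random walk operator\<close>

context infinite_graph
begin

abbreviation w :: "'a \<Rightarrow> real" where
  "w \<equiv> vertex_weight V \<mu>"

text \<open>
  The operator is given on neighbours rather than by an infinite sum, and on any real vector space of
  values: quadratic forms are studied on real functions, while the spectrum lives on complex ones.
\<close>
definition walk :: "('a \<Rightarrow> 'b::real_vector) \<Rightarrow> 'a \<Rightarrow> 'b" where
  "walk f x = (\<Sum>y\<in>E `` {x}. \<mu> x y *\<^sub>R f y) /\<^sub>R w x"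

lemma weight_outside_edges: "x \<in> V \<Longrightarrow> y \<in> V \<Longrightarrow> (x, y) \<notin> E \<Longrightarrow> \<mu> x y = 0"
  using weight_nonneg[of x y] weight_pos_iff[of x y] by force

lemma finite_Image_edges:
  assumes "finite W"
  shows "finite (E `` W)"
proof -
  have "finite (E `` {x})" for x
  proof (cases "x \<in> V")
    case True
    then show ?thesis using locally_finite[of x] by (simp add: Image_def)
  next
    case False
    then have "E `` {x} = {}" using edges_subset by auto
    then show ?thesis by simp
  qed
  moreover have "E `` W = (\<Union>x\<in>W. E `` {x})" by auto
  ultimately show ?thesis using assms by simp
qed

lemma Image_edges_subset: "E `` W \<subseteq> V"
  using edges_subset by auto

lemma sum_neighbours:
  fixes f :: "'a \<Rightarrow> 'b::real_vector"
  assumes "x \<in> V" "finite W" "W \<subseteq> V" "\<And>y. y \<in> E `` {x} \<Longrightarrow> y \<notin> W \<Longrightarrow> f y = 0"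
  shows "(\<Sum>y\<in>E `` {x}. \<mu> x y *\<^sub>R f y) = (\<Sum>y\<in>W. \<mu> x y *\<^sub>R f y)"
proof (rule sum.mono_neutral_cong)
  show "finite (E `` {x})" by (simp add: finite_Image_edges)
  show "finite W" by fact
  show "\<mu> x y *\<^sub>R f y = 0" if "y \<in> W - E `` {x}" for y
    using that assms weight_outside_edges[of x y] by auto
  show "\<mu> x y *\<^sub>R f y = 0" if "y \<in> E `` {x} - W" for y
    using that assms by auto
qed simp

lemma infsum_neighbours:
  fixes g :: "'a \<Rightarrow> 'b::{comm_monoid_add,t2_space}"
  assumes "x \<in> V" "\<And>y. y \<in> V \<Longrightarrow> \<mu> x y = 0 \<Longrightarrow> g y = 0"
  shows "(\<Sum>\<^sub>\<infinity>y\<in>V. g y) = (\<Sum>y\<in>E `` {x}. g y)"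
proof -
  have "(\<Sum>\<^sub>\<infinity>y\<in>V. g y) = (\<Sum>\<^sub>\<infinity>y\<in>E `` {x}. g y)"
    using assms edges_subset by (intro infsum_cong_neutral) (auto intro: weight_outside_edges)
  then show ?thesis by (simp add: finite_Image_edges)
qed

lemma vertex_weight_neighbours: "x \<in> V \<Longrightarrow> w x = (\<Sum>y\<in>E `` {x}. \<mu> x y)"
  unfolding vertex_weight_def by (rule infsum_neighbours) auto

lemma vertex_weight_eq_sum:
  assumes "x \<in> V" "finite W" "W \<subseteq> V" "E `` {x} \<subseteq> W"
  shows "w x = (\<Sum>y\<in>W. \<mu> x y)"
  using sum_neighbours[OF assms(1-3), of "\<lambda>_. 1::real"] assms
  by (simp add: vertex_weight_neighbours subset_iff)

lemma sum_weight_le_vertex_weight: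
  assumes "x \<in> V" "finite W" "W \<subseteq> V"
  shows "(\<Sum>y\<in>W. \<mu> x y) \<le> w x"
proof -
  have "(\<Sum>y\<in>W. \<mu> x y) \<le> (\<Sum>y\<in>W \<union> E `` {x}. \<mu> x y)"
    using assms Image_edges_subset[of "{x}"] finite_Image_edges[of "{x}"]
    by (intro sum_mono2) (auto intro: weight_nonneg)
  also have "\<dots> = w x"
    using assms Image_edges_subset[of "{x}"] finite_Image_edges[of "{x}"]
    by (intro vertex_weight_eq_sum[symmetric]) auto
  finally show ?thesis .
qed

lemma vertex_weight_pos:
  assumes "x \<in> V"
  shows "0 < w x"
proof -
  obtain y where y: "y \<in> V" "y \<noteq> x"
    using infinite_vertices by (metis assms finite.emptyI finite_insert insertCI subsetI subset_singleton_iff)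
  have "(x, y) \<in> E\<^sup>*" using connected_graph assms y by blast
  then obtain z where z: "(x, z) \<in> E"
    using y by (auto elim: converse_rtranclE)
  then have "z \<in> V" using edges_subset by auto
  have "0 < \<mu> x z" using weight_pos_iff[of x z] assms z \<open>z \<in> V\<close> by simp
  also have "\<mu> x z \<le> w x"
    using sum_weight_le_vertex_weight[of x "{z}"] assms \<open>z \<in> V\<close> by simp
  finally show ?thesis .
qed

lemma vertex_weight_nonneg: "x \<in> V \<Longrightarrow> 0 \<le> w x"
  using vertex_weight_pos by (simp add: less_imp_le)

lemma walk_outside: "x \<notin> V \<Longrightarrow> walk f x = 0"
proof -
  assume "x \<notin> V"
  then have "E `` {x} = {}" using edges_subset by auto
  then show ?thesis by (simp add: walk_def)
qed

lemma walk_supported: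
  fixes f :: "'a \<Rightarrow> 'b::real_vector"
  assumes "x \<in> V" "finite W" "W \<subseteq> V" "\<And>y. y \<notin> W \<Longrightarrow> f y = 0"
  shows "w x *\<^sub>R walk f x = (\<Sum>y\<in>W. \<mu> x y *\<^sub>R f y)"
  using sum_neighbours[OF assms(1-3), of f] assms(4) vertex_weight_pos[OF assms(1)]
  by (simp add: walk_def)

lemma walk_linear:
  fixes f g :: "'a \<Rightarrow> 'b::real_vector"
  shows "walk (\<lambda>x. a *\<^sub>R f x + b *\<^sub>R g x) x = a *\<^sub>R walk f x + b *\<^sub>R walk g x"
  by (simp add: walk_def scaleR_add_right sum.distrib scaleR_sum_right mult_ac)

lemma laplacian_eq_walk:
  assumes "\<And>y. y \<notin> V \<Longrightarrow> f y = 0"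
  shows "laplacian V \<mu> f x = f x - walk f x"
proof (cases "x \<in> V")
  case True
  have "(\<Sum>\<^sub>\<infinity>y\<in>V. complex_of_real (\<mu> x y) * f y) = (\<Sum>y\<in>E `` {x}. complex_of_real (\<mu> x y) * f y)"
    using True by (intro infsum_neighbours) auto
  with True show ?thesis
    by (simp add: laplacian_def walk_def scaleR_conv_of_real divide_inverse)
qed (simp add: laplacian_def assms walk_outside)

text \<open>
  The walk averages, so by Cauchy-Schwarz its square is dominated by the average of the squares; the
  symmetry of the weights turns the sum of these averages back into the squared norm. The window F
  is independent of the support W because P f spills over the boundary of W.
\<close>
lemma walk_contraction_real:
  fixes f :: "'a \<Rightarrow> real"
  assumes "finite W" "W \<subseteq> V" "\<And>y. y \<notin> W \<Longrightarrow> f y = 0" "finite F" "F \<subseteq> V"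
  shows "(\<Sum>x\<in>F. w x * (walk f x)\<^sup>2) \<le> (\<Sum>x\<in>W. w x * (f x)\<^sup>2)"
proof -
  have "w x * (walk f x)\<^sup>2 \<le> (\<Sum>y\<in>W. \<mu> x y * (f y)\<^sup>2)" if "x \<in> F" for x
  proof -
    have x: "x \<in> V" using that assms by auto
    have mu: "0 \<le> \<mu> x y" if "y \<in> W" for y using weight_nonneg x that assms by auto
    have "(w x * walk f x)\<^sup>2 = (\<Sum>y\<in>W. sqrt (\<mu> x y) * (sqrt (\<mu> x y) * f y))\<^sup>2"
      using walk_supported[OF x assms(1,2), of f] assms(3) mu
      by (simp flip: mult.assoc cong: sum.cong)
    also have "\<dots> \<le> (\<Sum>y\<in>W. (sqrt (\<mu> x y))\<^sup>2) * (\<Sum>y\<in>W. (sqrt (\<mu> x y) * f y)\<^sup>2)"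
      by (rule Cauchy_Schwarz_ineq_sum)
    also have "\<dots> = (\<Sum>y\<in>W. \<mu> x y) * (\<Sum>y\<in>W. \<mu> x y * (f y)\<^sup>2)"
      using mu by (simp add: power_mult_distrib)
    also have "\<dots> \<le> w x * (\<Sum>y\<in>W. \<mu> x y * (f y)\<^sup>2)"
      using mu by (intro mult_right_mono sum_weight_le_vertex_weight x assms sum_nonneg) auto
    finally have "w x * (w x * (walk f x)\<^sup>2) \<le> w x * (\<Sum>y\<in>W. \<mu> x y * (f y)\<^sup>2)"
      by (simp add: power2_eq_square mult_ac)
    then show ?thesis using vertex_weight_pos[OF x] by simp
  qed
  then have "(\<Sum>x\<in>F. w x * (walk f x)\<^sup>2) \<le> (\<Sum>x\<in>F. \<Sum>y\<in>W. \<mu> x y * (f y)\<^sup>2)"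
    by (rule sum_mono)
  also have "\<dots> = (\<Sum>y\<in>W. (\<Sum>x\<in>F. \<mu> y x) * (f y)\<^sup>2)"
    unfolding sum_distrib_right using assms
    by (subst sum.swap) (intro sum.cong refl arg_cong2[where f="(*)"] weight_sym, auto)
  also have "\<dots> \<le> (\<Sum>y\<in>W. w y * (f y)\<^sup>2)"
    using assms by (intro sum_mono mult_right_mono sum_weight_le_vertex_weight) auto
  finally show ?thesis .
qed

lemma walk_symmetric:
  fixes f g :: "'a \<Rightarrow> real"
  assumes "finite W" "W \<subseteq> V" "\<And>y. y \<notin> W \<Longrightarrow> f y = 0" "\<And>y. y \<notin> W \<Longrightarrow> g y = 0"
  shows "(\<Sum>x\<in>W. w x * (f x * walk g x)) = (\<Sum>x\<in>W. w x * (walk f x * g x))"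
proof -
  have "(\<Sum>x\<in>W. w x * (f x * walk g x)) = (\<Sum>x\<in>W. \<Sum>y\<in>W. f x * (\<mu> x y * g y))"
    using assms walk_supported[OF _ assms(1,2), of _ g]
    by (intro sum.cong) (auto simp: mult.left_commute sum_distrib_left subset_iff)
  also have "\<dots> = (\<Sum>y\<in>W. \<Sum>x\<in>W. (\<mu> y x * f x) * g y)"
    using assms weight_sym by (subst sum.swap) (intro sum.cong, auto simp: mult_ac subset_iff)
  also have "\<dots> = (\<Sum>x\<in>W. w x * (walk f x * g x))"
    using assms walk_supported[OF _ assms(1,2), of _ f]
    by (intro sum.cong) (auto simp flip: sum_distrib_right mult.assoc simp: subset_iff)
  finally show ?thesis .
qed

section \<open>The signless quadratic form\<close>

text \<open>
  A lower bound for 1 + P as a quadratic form. Finitely supported functions suffice because they are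
  dense, and on them every sum is finite.
\<close>

definition signless_bound :: "real \<Rightarrow> bool" where
  "signless_bound c \<longleftrightarrow> (\<forall>W f. finite W \<longrightarrow> W \<subseteq> V \<longrightarrow> (\<forall>x. x \<notin> W \<longrightarrow> f x = 0) \<longrightarrow>
     c * (\<Sum>x\<in>W. w x * (f x)\<^sup>2) \<le> (\<Sum>x\<in>W. w x * (f x * (f x + walk f x))))"

lemma abs_walk_form_le:
  fixes f :: "'a \<Rightarrow> real"
  assumes "finite W" "W \<subseteq> V" "\<And>y. y \<notin> W \<Longrightarrow> f y = 0"
  shows "\<bar>\<Sum>x\<in>W. w x * (f x * walk f x)\<bar> \<le> (\<Sum>x\<in>W. w x * (f x)\<^sup>2)"
proof -
  have "\<bar>\<Sum>x\<in>W. w x * (f x * walk f x)\<bar> \<le> (\<Sum>x\<in>W. w x * ((f x)\<^sup>2 + (walk f x)\<^sup>2) / 2)"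
  proof (rule order_trans[OF sum_abs], rule sum_mono)
    fix x assume "x \<in> W"
    then have "0 \<le> w x" using vertex_weight_nonneg assms by auto
    moreover have "2 * \<bar>f x * walk f x\<bar> \<le> (f x)\<^sup>2 + (walk f x)\<^sup>2"
      using sum_squares_bound[of "\<bar>f x\<bar>" "\<bar>walk f x\<bar>"] by (simp add: abs_mult)
    ultimately show "\<bar>w x * (f x * walk f x)\<bar> \<le> w x * ((f x)\<^sup>2 + (walk f x)\<^sup>2) / 2"
      using mult_left_mono[of "2 * \<bar>f x * walk f x\<bar>" "(f x)\<^sup>2 + (walk f x)\<^sup>2" "w x"]
      by (simp add: abs_mult)
  qed
  also have "\<dots> = ((\<Sum>x\<in>W. w x * (f x)\<^sup>2) + (\<Sum>x\<in>W. w x * (walk f x)\<^sup>2)) / 2"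
    by (simp add: sum_divide_distrib[symmetric] distrib_left sum.distrib)
  also have "\<dots> \<le> (\<Sum>x\<in>W. w x * (f x)\<^sup>2)"
    using walk_contraction_real[of W f W] assms by simp
  finally show ?thesis .
qed

lemma signless_bound_0: "signless_bound 0"
  unfolding signless_bound_def
proof (intro allI impI)
  fix W and f :: "'a \<Rightarrow> real"
  assume W: "finite W" "W \<subseteq> V" "\<forall>x. x \<notin> W \<longrightarrow> f x = 0"
  show "0 * (\<Sum>x\<in>W. w x * (f x)\<^sup>2) \<le> (\<Sum>x\<in>W. w x * (f x * (f x + walk f x)))"
    using abs_walk_form_le[of W f] W
    by (simp add: distrib_left sum.distrib power2_eq_square)
qed

lemma signless_bound_le_2:
  assumes "signless_bound c"
  shows "c \<le> 2"
proof -
  obtain a where a: "a \<in> V" using infinite_vertices by (metis finite.emptyI ex_in_conv)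
  define f :: "'a \<Rightarrow> real" where "f x = (if x = a then 1 else 0)" for x
  have "c * w a \<le> w a * (1 + walk f a)"
    using assms[unfolded signless_bound_def, rule_format, of "{a}" f] a by (simp add: f_def)
  moreover have "\<bar>w a * walk f a\<bar> \<le> w a"
    using abs_walk_form_le[of "{a}" f] a by (simp add: f_def)
  ultimately have "c * w a \<le> 2 * w a" by (simp add: distrib_left)
  then show ?thesis using vertex_weight_pos[OF a] by simp
qed

section \<open>The dual Cheeger constant of finite sets\<close>

lemma edge_weight_commute:
  assumes "V1 \<subseteq> V" "V2 \<subseteq> V"
  shows "edge_weight \<mu> V1 V2 = edge_weight \<mu> V2 V1"
  unfolding edge_weight_def using assms weight_sym
  by (subst sum.swap) (intro sum.cong, auto)

lemma edge_weight_Un_le_vol: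
  assumes "finite U" "U \<subseteq> V" "finite V1" "V1 \<subseteq> V" "finite V2" "V2 \<subseteq> V" "V1 \<inter> V2 = {}"
  shows "edge_weight \<mu> U V1 + edge_weight \<mu> U V2 \<le> vol V \<mu> U"
proof -
  have "edge_weight \<mu> U V1 + edge_weight \<mu> U V2 = (\<Sum>x\<in>U. \<Sum>y\<in>V1 \<union> V2. \<mu> x y)"
    using assms by (simp add: edge_weight_def sum.union_disjoint sum.distrib)
  also have "\<dots> \<le> vol V \<mu> U"
    unfolding vol_def using assms by (intro sum_mono sum_weight_le_vertex_weight) auto
  finally show ?thesis .
qed

lemma edge_weight_nonneg:
  assumes "V1 \<subseteq> V" "V2 \<subseteq> V"
  shows "0 \<le> edge_weight \<mu> V1 V2"
  unfolding edge_weight_def using assms by (intro sum_nonneg weight_nonneg) auto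

lemma vol_nonneg: "U \<subseteq> V \<Longrightarrow> 0 \<le> vol V \<mu> U"
  unfolding vol_def by (intro sum_nonneg vertex_weight_nonneg) auto

lemma vol_pos: "finite U \<Longrightarrow> U \<subseteq> V \<Longrightarrow> U \<noteq> {} \<Longrightarrow> 0 < vol V \<mu> U"
  unfolding vol_def by (intro sum_pos vertex_weight_pos) auto

lemma two_edge_weight_le_vol:
  assumes "finite V1" "V1 \<subseteq> V" "finite V2" "V2 \<subseteq> V" "V1 \<inter> V2 = {}"
  shows "2 * edge_weight \<mu> V1 V2 \<le> vol V \<mu> V1 + vol V \<mu> V2"
  using edge_weight_Un_le_vol[of V1 V1 V2] edge_weight_Un_le_vol[of V2 V1 V2]
    edge_weight_nonneg[of V1 V1] edge_weight_nonneg[of V2 V2]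
    edge_weight_commute[of V1 V2] assms by simp

lemma dual_cheeger_upper:
  assumes "finite V1" "V1 \<subseteq> V" "finite V2" "V2 \<subseteq> V" "V1 \<inter> V2 = {}" "V1 \<noteq> {}" "V2 \<noteq> {}"
  shows "2 * edge_weight \<mu> V1 V2 / (vol V \<mu> V1 + vol V \<mu> V2) \<le> dual_cheeger V \<mu>"
  unfolding dual_cheeger_def
proof (rule cSup_upper)
  show "bdd_above {2 * edge_weight \<mu> V1 V2 / (vol V \<mu> V1 + vol V \<mu> V2) | V1 V2.
            V1 \<subseteq> V \<and> V2 \<subseteq> V \<and> finite V1 \<and> finite V2 \<and>
            V1 \<noteq> {} \<and> V2 \<noteq> {} \<and> V1 \<inter> V2 = {}}"
  proof (rule bdd_aboveI[of _ 1], clarify)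
    fix V1 V2
    assume *: "V1 \<subseteq> V" "V2 \<subseteq> V" "finite V1" "finite V2" "V1 \<noteq> {}" "V2 \<noteq> {}" "V1 \<inter> V2 = {}"
    show "2 * edge_weight \<mu> V1 V2 / (vol V \<mu> V1 + vol V \<mu> V2) \<le> 1"
      using two_edge_weight_le_vol[of V1 V2] vol_pos[of V1] vol_pos[of V2] * by simp
  qed
qed (use assms in blast)

lemma obtain_two_vertices:
  obtains a b where "a \<in> V" "b \<in> V" "a \<noteq> b"
proof -
  obtain a where "a \<in> V" using infinite_vertices by (metis finite.emptyI ex_in_conv)
  moreover obtain b where "b \<in> V - {a}"
    using infinite_vertices by (metis finite.emptyI ex_in_conv infinite_remove)
  ultimately show ?thesis using that by auto
qed

lemma dual_cheeger_least:
  assumes "\<And>V1 V2. finite V1 \<Longrightarrow> V1 \<subseteq> V \<Longrightarrow> finite V2 \<Longrightarrow> V2 \<subseteq> V \<Longrightarrow> V1 \<inter> V2 = {} \<Longrightarrow>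
    2 * edge_weight \<mu> V1 V2 \<le> c * (vol V \<mu> V1 + vol V \<mu> V2)"
  shows "dual_cheeger V \<mu> \<le> c"
  unfolding dual_cheeger_def
proof (rule cSup_least)
  obtain a b where "a \<in> V" "b \<in> V" "a \<noteq> b" by (rule obtain_two_vertices)
  then have "{a} \<subseteq> V \<and> {b} \<subseteq> V \<and> finite {a} \<and> finite {b} \<and> {a} \<noteq> {} \<and> {b} \<noteq> {} \<and> {a} \<inter> {b} = {}"
    by auto
  then show "{2 * edge_weight \<mu> V1 V2 / (vol V \<mu> V1 + vol V \<mu> V2) | V1 V2.
            V1 \<subseteq> V \<and> V2 \<subseteq> V \<and> finite V1 \<and> finite V2 \<and>
            V1 \<noteq> {} \<and> V2 \<noteq> {} \<and> V1 \<inter> V2 = {}} \<noteq> {}" by blast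
next
  fix r
  assume "r \<in> {2 * edge_weight \<mu> V1 V2 / (vol V \<mu> V1 + vol V \<mu> V2) | V1 V2.
            V1 \<subseteq> V \<and> V2 \<subseteq> V \<and> finite V1 \<and> finite V2 \<and>
            V1 \<noteq> {} \<and> V2 \<noteq> {} \<and> V1 \<inter> V2 = {}}"
  then obtain V1 V2 where *: "V1 \<subseteq> V" "V2 \<subseteq> V" "finite V1" "finite V2" "V1 \<noteq> {}" "V2 \<noteq> {}"
    "V1 \<inter> V2 = {}" and r: "r = 2 * edge_weight \<mu> V1 V2 / (vol V \<mu> V1 + vol V \<mu> V2)"
    by auto
  show "r \<le> c"
    using assms[of V1 V2] vol_pos[of V1] vol_pos[of V2] *
    by (simp add: r pos_divide_le_eq)
qed

lemma dual_cheeger_nonneg: "0 \<le> dual_cheeger V \<mu>"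
proof -
  obtain a b where ab: "a \<in> V" "b \<in> V" "a \<noteq> b" by (rule obtain_two_vertices)
  have "0 \<le> 2 * edge_weight \<mu> {a} {b} / (vol V \<mu> {a} + vol V \<mu> {b})"
    using ab edge_weight_nonneg[of "{a}" "{b}"] vol_nonneg[of "{a}"] vol_nonneg[of "{b}"] by simp
  also have "\<dots> \<le> dual_cheeger V \<mu>" using ab by (intro dual_cheeger_upper) auto
  finally show ?thesis .
qed

text \<open>
  The supremum ranges over nonempty sets, but a level set of a function may well have one sign only;
  then the edge weight is 0 and the inequality says that the dual Cheeger constant is nonnegative.
\<close>
lemma two_edge_weight_le_dual_cheeger:
  assumes "finite V1" "V1 \<subseteq> V" "finite V2" "V2 \<subseteq> V" "V1 \<inter> V2 = {}"
  shows "2 * edge_weight \<mu> V1 V2 \<le> dual_cheeger V \<mu> * (vol V \<mu> V1 + vol V \<mu> V2)"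
proof (cases "V1 = {} \<or> V2 = {}")
  case True
  then have "edge_weight \<mu> V1 V2 = 0" by (auto simp: edge_weight_def)
  then show ?thesis
    using dual_cheeger_nonneg vol_nonneg[of V1] vol_nonneg[of V2] assms by simp
next
  case False
  then show ?thesis
    using dual_cheeger_upper[of V1 V2] vol_pos[of V1] vol_pos[of V2] assms
    by (simp add: pos_divide_le_eq)
qed

section \<open>The dual Cheeger inequality\<close>

lemma signless_form_eq_edges:
  fixes f :: "'a \<Rightarrow> real"
  assumes "finite W" "W \<subseteq> V" "\<And>y. y \<notin> W \<Longrightarrow> f y = 0"
  shows "(\<Sum>x\<in>W. w x * (f x * (f x + walk f x))) =
    (\<Sum>x\<in>W. w x * (f x)\<^sup>2) + (\<Sum>x\<in>W. \<Sum>y\<in>W. \<mu> x y * (f x * f y))"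
proof -
  have "w x * (f x * (f x + walk f x)) = w x * (f x)\<^sup>2 + (\<Sum>y\<in>W. \<mu> x y * (f x * f y))"
    if "x \<in> W" for x
  proof -
    have "w x * (f x * (f x + walk f x)) = w x * (f x)\<^sup>2 + f x * (w x *\<^sub>R walk f x)"
      by (simp add: algebra_simps power2_eq_square)
    also have "w x *\<^sub>R walk f x = (\<Sum>y\<in>W. \<mu> x y * f y)"
      using walk_supported[of x W f] that assms by auto
    finally show ?thesis by (simp add: sum_distrib_left mult_ac)
  qed
  then show ?thesis by (simp add: sum.distrib)
qed

text \<open>
  For the function with values 1 on \<open>V1\<close> and -1 on \<open>V2\<close>, edges between the two sets cancel in
  the signless form, and every other edge contributes at most twice its share of the volume.
\<close>
lemma dual_cheeger_le_of_signless_bound: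
  assumes "signless_bound c"
  shows "dual_cheeger V \<mu> \<le> 1 - c / 2"
proof (rule dual_cheeger_least)
  fix V1 V2
  assume *: "finite V1" "V1 \<subseteq> V" "finite V2" "V2 \<subseteq> V" "V1 \<inter> V2 = {}"
  define f :: "'a \<Rightarrow> real" where "f x = (if x \<in> V1 then 1 else if x \<in> V2 then -1 else 0)" for x
  have f1: "f x = 1" if "x \<in> V1" for x using that by (simp add: f_def)
  have f2: "f x = -1" if "x \<in> V2" for x using that * by (auto simp add: f_def)
  have split: "(\<Sum>x\<in>V1 \<union> V2. g x) = (\<Sum>x\<in>V1. g x) + (\<Sum>x\<in>V2. g x)" for g :: "'a \<Rightarrow> real"
    using * by (simp add: sum.union_disjoint)
  have sq: "(\<Sum>x\<in>V1 \<union> V2. w x * (f x)\<^sup>2) = vol V \<mu> V1 + vol V \<mu> V2"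
    by (simp add: split f1 f2 vol_def)
  have "(\<Sum>x\<in>V1 \<union> V2. \<Sum>y\<in>V1 \<union> V2. \<mu> x y * (f x * f y)) =
      edge_weight \<mu> V1 V1 + edge_weight \<mu> V2 V2 - edge_weight \<mu> V1 V2 - edge_weight \<mu> V2 V1"
    by (simp add: split f1 f2 edge_weight_def sum.distrib sum_negf sum_subtractf)
  moreover have "c * (\<Sum>x\<in>V1 \<union> V2. w x * (f x)\<^sup>2)
      \<le> (\<Sum>x\<in>V1 \<union> V2. w x * (f x * (f x + walk f x)))"
    using * by (intro assms[unfolded signless_bound_def, rule_format]) (auto simp: f_def)
  ultimately have "c * (vol V \<mu> V1 + vol V \<mu> V2) \<le> vol V \<mu> V1 + vol V \<mu> V2 +
      (edge_weight \<mu> V1 V1 + edge_weight \<mu> V2 V2 - edge_weight \<mu> V1 V2 - edge_weight \<mu> V2 V1)"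
    using signless_form_eq_edges[of "V1 \<union> V2" f] * sq by (simp add: f_def)
  moreover have "edge_weight \<mu> V1 V1 + edge_weight \<mu> V1 V2 \<le> vol V \<mu> V1"
    "edge_weight \<mu> V2 V1 + edge_weight \<mu> V2 V2 \<le> vol V \<mu> V2"
    using * by (auto intro: edge_weight_Un_le_vol)
  moreover have "edge_weight \<mu> V1 V2 = edge_weight \<mu> V2 V1"
    using * by (intro edge_weight_commute)
  ultimately show "2 * edge_weight \<mu> V1 V2 \<le> (1 - c / 2) * (vol V \<mu> V1 + vol V \<mu> V2)"
    by (simp add: algebra_simps)
qed

text \<open>
  For a function with values a and b at the ends of an edge, this is the length of the set of levels
  \<tau> \<ge> 0 at which the first end lies in the positive and the second end in the negative half of
  the set where the square exceeds \<tau>.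
\<close>
definition opposite_min :: "real \<Rightarrow> real \<Rightarrow> real" where
  "opposite_min a b = (if a > 0 \<and> b < 0 then min (a\<^sup>2) (b\<^sup>2) else 0)"

lemma has_integral_below_level:
  fixes a M :: real
  assumes "0 \<le> a" "a \<le> M"
  shows "((\<lambda>\<tau>. if \<tau> < a then 1 else 0) has_integral a) {0..M}"
proof -
  have "((\<lambda>\<tau>. 1::real) has_integral a) {0..a}"
    using has_integral_const_real[of "1::real" 0 a] assms by simp
  then have "((\<lambda>\<tau>. if \<tau> \<in> {0..a} then 1 else 0::real) has_integral a) {0..M}"
    using assms by (subst has_integral_restrict) auto
  then show ?thesis
    by (rule has_integral_spike_finite[of "{a}", rotated 2]) auto
qed

text \<open>
  This is the layer-cake argument: at each level the inequality is the one that defines the dual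
  Cheeger constant, and integrating the indicators of the levels yields the squares and the minima.
\<close>
lemma level_set_integration:
  fixes f :: "'a \<Rightarrow> real"
  assumes W: "finite W" "W \<subseteq> V"
  shows "2 * (\<Sum>x\<in>W. \<Sum>y\<in>W. \<mu> x y * opposite_min (f x) (f y))
    \<le> dual_cheeger V \<mu> * (\<Sum>x\<in>W. w x * (f x)\<^sup>2)"
proof -
  define M where "M = (\<Sum>x\<in>W. (f x)\<^sup>2)"
  have M: "(f x)\<^sup>2 \<le> M" if "x \<in> W" for x
    unfolding M_def using W that by (intro member_le_sum) auto
  define p :: "real \<Rightarrow> real \<Rightarrow> real" where "p a \<tau> = (if \<tau> < a then 1 else 0)" for a \<tau>
  define V1 where "V1 \<tau> = {x \<in> W. f x > 0 \<and> \<tau> < (f x)\<^sup>2}" for \<tau>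
  define V2 where "V2 \<tau> = {x \<in> W. f x < 0 \<and> \<tau> < (f x)\<^sup>2}" for \<tau>
  have "(p (opposite_min (f x) (f y)) has_integral opposite_min (f x) (f y)) {0..M}"
    if "x \<in> W" "y \<in> W" for x y
    unfolding p_def using M[of x] M[of y] that order_trans[OF zero_le_power2 M[of x]]
    by (intro has_integral_below_level) (auto simp: opposite_min_def)
  then have int1: "((\<lambda>\<tau>. 2 * (\<Sum>x\<in>W. \<Sum>y\<in>W. \<mu> x y * p (opposite_min (f x) (f y)) \<tau>)) has_integral
      2 * (\<Sum>x\<in>W. \<Sum>y\<in>W. \<mu> x y * opposite_min (f x) (f y))) {0..M}"
    using W by (intro has_integral_mult_right has_integral_sum) auto
  have "(p ((f x)\<^sup>2) has_integral (f x)\<^sup>2) {0..M}" if "x \<in> W" for x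
    unfolding p_def using M[of x] that by (intro has_integral_below_level) auto
  then have int2: "((\<lambda>\<tau>. dual_cheeger V \<mu> * (\<Sum>x\<in>W. w x * p ((f x)\<^sup>2) \<tau>)) has_integral
      dual_cheeger V \<mu> * (\<Sum>x\<in>W. w x * (f x)\<^sup>2)) {0..M}"
    using W by (intro has_integral_mult_right has_integral_sum) auto
  show ?thesis
  proof (rule has_integral_le[OF int1 int2])
    fix \<tau> assume "\<tau> \<in> {0..M}"
    then have \<tau>: "0 \<le> \<tau>" by simp
    have "(\<Sum>x\<in>W. \<Sum>y\<in>W. \<mu> x y * p (opposite_min (f x) (f y)) \<tau>) =
        (\<Sum>x\<in>W. \<Sum>y\<in>W. if x \<in> V1 \<tau> then if y \<in> V2 \<tau> then \<mu> x y else 0 else 0)"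
      using \<tau> by (intro sum.cong) (auto simp: p_def opposite_min_def V1_def V2_def)
    also have "\<dots> = (\<Sum>x\<in>W. if x \<in> V1 \<tau> then \<Sum>y\<in>W. if y \<in> V2 \<tau> then \<mu> x y else 0 else 0)"
      by (intro sum.cong) auto
    also have "\<dots> = edge_weight \<mu> (V1 \<tau>) (V2 \<tau>)"
    proof -
      have "(\<Sum>y\<in>W. if y \<in> V2 \<tau> then \<mu> x y else 0) = (\<Sum>y\<in>V2 \<tau>. \<mu> x y)" for x
        using W by (intro sum.mono_neutral_cong_right) (auto simp: V2_def)
      then show ?thesis
        unfolding edge_weight_def using W by (intro sum.mono_neutral_cong_right) (auto simp: V1_def)
    qed
    finally have e: "(\<Sum>x\<in>W. \<Sum>y\<in>W. \<mu> x y * p (opposite_min (f x) (f y)) \<tau>) =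
      edge_weight \<mu> (V1 \<tau>) (V2 \<tau>)" .
    have "(\<Sum>x\<in>W. w x * p ((f x)\<^sup>2) \<tau>) = (\<Sum>x\<in>W. if x \<in> V1 \<tau> \<union> V2 \<tau> then w x else 0)"
    proof (rule sum.cong)
      fix x assume "x \<in> W"
      moreover have "f x = 0 \<Longrightarrow> \<not> \<tau> < (f x)\<^sup>2" using \<tau> by simp
      ultimately show "w x * p ((f x)\<^sup>2) \<tau> = (if x \<in> V1 \<tau> \<union> V2 \<tau> then w x else 0)"
        by (cases "f x" "0::real" rule: linorder_cases) (auto simp: p_def V1_def V2_def)
    qed simp
    also have "\<dots> = (\<Sum>x\<in>V1 \<tau> \<union> V2 \<tau>. w x)"
      using W by (intro sum.mono_neutral_cong_right) (auto simp: V1_def V2_def)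
    also have "\<dots> = vol V \<mu> (V1 \<tau>) + vol V \<mu> (V2 \<tau>)"
      unfolding vol_def using W by (intro sum.union_disjoint) (auto simp: V1_def V2_def)
    finally have v: "(\<Sum>x\<in>W. w x * p ((f x)\<^sup>2) \<tau>) = vol V \<mu> (V1 \<tau>) + vol V \<mu> (V2 \<tau>)" .
    show "2 * (\<Sum>x\<in>W. \<Sum>y\<in>W. \<mu> x y * p (opposite_min (f x) (f y)) \<tau>)
        \<le> dual_cheeger V \<mu> * (\<Sum>x\<in>W. w x * p ((f x)\<^sup>2) \<tau>)"
      unfolding e v using W by (intro two_edge_weight_le_dual_cheeger) (auto simp: V1_def V2_def)
  qed
qed

text \<open>
  The left side, the part of an edge missed by the level sets, is at most
  |a + b| (|a| + |b|) / 2: for opposite signs it is |a^2 - b^2| / 2, and for equal signs the level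
  sets contribute nothing and |a + b| = |a| + |b|. Young's inequality with parameter \<eta> separates
  the two factors, so that the first can be summed to the signless form and the second to the norm.
\<close>
lemma opposite_min_deficit:
  fixes a b \<eta> :: real
  assumes "0 < \<eta>"
  shows "(a\<^sup>2 + b\<^sup>2) / 2 - opposite_min a b - opposite_min b a
    \<le> (a + b)\<^sup>2 / (2 * \<eta>) + \<eta> * (a\<^sup>2 + b\<^sup>2) / 4"
proof -
  let ?u = "\<bar>a + b\<bar>" and ?v = "\<bar>a\<bar> + \<bar>b\<bar>"
  have deficit: "a\<^sup>2 + b\<^sup>2 - 2 * opposite_min a b - 2 * opposite_min b a \<le> ?u * ?v"
  proof (cases "a > 0 \<and> b < 0 \<or> a < 0 \<and> b > 0")
    case True
    have "?u * ?v = \<bar>a + b\<bar> * \<bar>a - b\<bar>" using True by auto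
    also have "\<dots> = \<bar>a\<^sup>2 - b\<^sup>2\<bar>"
      by (simp add: abs_mult[symmetric] power2_eq_square algebra_simps)
    also have "\<dots> = a\<^sup>2 + b\<^sup>2 - 2 * min (a\<^sup>2) (b\<^sup>2)" by (simp add: min_def)
    also have "\<dots> = a\<^sup>2 + b\<^sup>2 - 2 * opposite_min a b - 2 * opposite_min b a"
      using True by (auto simp: opposite_min_def min.commute)
    finally show ?thesis by simp
  next
    case False
    then have "?u = ?v" by auto
    moreover have "a\<^sup>2 + b\<^sup>2 \<le> ?v * ?v"
      using mult_nonneg_nonneg[of "\<bar>a\<bar>" "\<bar>b\<bar>"] by (simp add: algebra_simps power2_eq_square)
    ultimately show ?thesis using False by (auto simp: opposite_min_def)
  qed
  have young: "2 * (?u * ?v) \<le> 2 * ?u\<^sup>2 / \<eta> + \<eta> * ?v\<^sup>2 / 2"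
  proof -
    have "0 \<le> (2 * ?u - \<eta> * ?v)\<^sup>2 / (2 * \<eta>)" using assms by simp
    also have "\<dots> = 2 * ?u\<^sup>2 / \<eta> + \<eta> * ?v\<^sup>2 / 2 - 2 * (?u * ?v)"
      using assms by (simp add: power2_eq_square field_simps)
    finally show ?thesis by simp
  qed
  have "?v\<^sup>2 \<le> 2 * (a\<^sup>2 + b\<^sup>2)"
    using sum_squares_bound[of "\<bar>a\<bar>" "\<bar>b\<bar>"] by (simp add: power2_sum)
  then have square: "\<eta> * ?v\<^sup>2 / 2 \<le> \<eta> * (a\<^sup>2 + b\<^sup>2)" using assms by simp
  have "2 * (a\<^sup>2 + b\<^sup>2 - 2 * opposite_min a b - 2 * opposite_min b a) \<le> 2 * (?u * ?v)"
    using deficit by (rule mult_left_mono) simp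
  also note young
  also have "2 * ?u\<^sup>2 / \<eta> + \<eta> * ?v\<^sup>2 / 2 \<le> 2 * ?u\<^sup>2 / \<eta> + \<eta> * (a\<^sup>2 + b\<^sup>2)"
    using square by (rule add_left_mono)
  finally have "2 * (a\<^sup>2 + b\<^sup>2 - 2 * opposite_min a b - 2 * opposite_min b a)
      \<le> 2 * ?u\<^sup>2 / \<eta> + \<eta> * (a\<^sup>2 + b\<^sup>2)" .
  then show ?thesis by (simp add: field_simps)
qed

text \<open>
  With N the squared norm of f and Q its signless form, summing the previous estimate over the edges
  gives \<eta> N \<le> Q / \<eta> + \<eta> N / 2, where the left side comes from the integrated level set
  inequality.
\<close>
lemma signless_bound_of_dual_cheeger:
  assumes \<eta>: "0 < \<eta>" and h: "dual_cheeger V \<mu> \<le> 1 - \<eta>"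
  shows "signless_bound (\<eta>\<^sup>2 / 2)"
  unfolding signless_bound_def
proof (intro allI impI)
  fix S and f :: "'a \<Rightarrow> real"
  assume S: "finite S" "S \<subseteq> V" "\<forall>x. x \<notin> S \<longrightarrow> f x = 0"
  \<comment> \<open>On this enlarged set the weights of the vertices of S are full row sums of the edge weights.\<close>
  define W where "W = S \<union> E `` S"
  have W: "finite W" "W \<subseteq> V" "S \<subseteq> W" "\<And>x. x \<notin> W \<Longrightarrow> f x = 0"
    using S finite_Image_edges Image_edges_subset by (auto simp: W_def)
  have to_W: "(\<Sum>x\<in>S. w x * (f x * g x)) = (\<Sum>x\<in>W. w x * (f x * g x))" for g
    using S W by (intro sum.mono_neutral_left) auto
  define N where "N = (\<Sum>x\<in>W. w x * (f x)\<^sup>2)"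
  define Q where "Q = (\<Sum>x\<in>W. w x * (f x * (f x + walk f x)))"
  have "w x * (f x)\<^sup>2 = (\<Sum>y\<in>W. \<mu> x y * (f x)\<^sup>2)" if "x \<in> W" for x
  proof (cases "x \<in> S")
    case True
    then have "w x = (\<Sum>y\<in>W. \<mu> x y)"
      using S W by (intro vertex_weight_eq_sum) (auto simp: W_def)
    then show ?thesis by (simp add: sum_distrib_right)
  qed (use S in simp)
  then have N1: "N = (\<Sum>x\<in>W. \<Sum>y\<in>W. \<mu> x y * (f x)\<^sup>2)" by (simp add: N_def)
  have swap: "(\<Sum>x\<in>W. \<Sum>y\<in>W. \<mu> x y * g y x) = (\<Sum>x\<in>W. \<Sum>y\<in>W. \<mu> x y * g x y)" for g
    using W by (subst sum.swap) (intro sum.cong refl arg_cong2[where f="(*)"] weight_sym, auto)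
  have N2: "N = (\<Sum>x\<in>W. \<Sum>y\<in>W. \<mu> x y * (f y)\<^sup>2)"
    using N1 swap[of "\<lambda>x y. (f x)\<^sup>2"] by simp
  have Q: "Q = N + (\<Sum>x\<in>W. \<Sum>y\<in>W. \<mu> x y * (f x * f y))"
    unfolding Q_def N_def using W by (intro signless_form_eq_edges) auto
  let ?T = "\<Sum>x\<in>W. \<Sum>y\<in>W. \<mu> x y * opposite_min (f x) (f y)"
  have T: "2 * ?T \<le> (1 - \<eta>) * N"
  proof -
    have "0 \<le> N" unfolding N_def using W by (intro sum_nonneg mult_nonneg_nonneg vertex_weight_nonneg) auto
    then have "dual_cheeger V \<mu> * N \<le> (1 - \<eta>) * N" using h by (rule mult_right_mono[rotated])
    then show ?thesis using level_set_integration[OF W(1,2), of f] by (simp add: N_def)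
  qed
  have "(\<Sum>x\<in>W. \<Sum>y\<in>W. \<mu> x y *
      (((f x)\<^sup>2 + (f y)\<^sup>2) / 2 - opposite_min (f x) (f y) - opposite_min (f y) (f x)))
    \<le> (\<Sum>x\<in>W. \<Sum>y\<in>W. \<mu> x y *
      ((f x + f y)\<^sup>2 / (2 * \<eta>) + \<eta> * ((f x)\<^sup>2 + (f y)\<^sup>2) / 4))"
    using W \<eta> by (intro sum_mono mult_left_mono opposite_min_deficit weight_nonneg) auto
  also have "(\<Sum>x\<in>W. \<Sum>y\<in>W. \<mu> x y *
      (((f x)\<^sup>2 + (f y)\<^sup>2) / 2 - opposite_min (f x) (f y) - opposite_min (f y) (f x))) = N - 2 * ?T"
  proof -
    have "\<mu> x y * (((f x)\<^sup>2 + (f y)\<^sup>2) / 2 - opposite_min (f x) (f y) - opposite_min (f y) (f x)) =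
        (\<mu> x y * (f x)\<^sup>2) / 2 + (\<mu> x y * (f y)\<^sup>2) / 2
          - \<mu> x y * opposite_min (f x) (f y) - \<mu> x y * opposite_min (f y) (f x)" for x y
      by (simp add: field_simps)
    then show ?thesis
      using swap[of "\<lambda>x y. opposite_min (f x) (f y)"]
      by (simp add: sum.distrib sum_subtractf flip: sum_divide_distrib N1 N2)
  qed
  also have "(\<Sum>x\<in>W. \<Sum>y\<in>W. \<mu> x y *
      ((f x + f y)\<^sup>2 / (2 * \<eta>) + \<eta> * ((f x)\<^sup>2 + (f y)\<^sup>2) / 4)) = Q / \<eta> + \<eta> * N / 2"
  proof -
    have "\<mu> x y * ((f x + f y)\<^sup>2 / (2 * \<eta>) + \<eta> * ((f x)\<^sup>2 + (f y)\<^sup>2) / 4) =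
        (1 / (2 * \<eta>) + \<eta> / 4) * (\<mu> x y * (f x)\<^sup>2) + (1 / (2 * \<eta>) + \<eta> / 4) * (\<mu> x y * (f y)\<^sup>2)
          + 1 / \<eta> * (\<mu> x y * (f x * f y))" for x y
      using \<eta> by (simp add: field_simps power2_eq_square)
    then have "(\<Sum>x\<in>W. \<Sum>y\<in>W. \<mu> x y *
        ((f x + f y)\<^sup>2 / (2 * \<eta>) + \<eta> * ((f x)\<^sup>2 + (f y)\<^sup>2) / 4)) =
        (1 / (2 * \<eta>) + \<eta> / 4) * N + (1 / (2 * \<eta>) + \<eta> / 4) * N + 1 / \<eta> * (Q - N)"
      by (simp only: sum.distrib flip: sum_distrib_left N1 N2) (simp add: Q)
    also have "\<dots> = Q / \<eta> + \<eta> * N / 2" using \<eta> by (simp add: field_simps)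
    finally show ?thesis .
  qed
  finally have "N - 2 * ?T \<le> Q / \<eta> + \<eta> * N / 2" .
  moreover have "(1 - \<eta>) * N = N - \<eta> * N" by (simp add: algebra_simps)
  ultimately have "\<eta> * N / 2 \<le> Q / \<eta>" using T by linarith
  then have "\<eta>\<^sup>2 / 2 * N \<le> Q" using \<eta> by (simp add: field_simps power2_eq_square)
  then show "\<eta>\<^sup>2 / 2 * (\<Sum>x\<in>S. w x * (f x)\<^sup>2) \<le> (\<Sum>x\<in>S. w x * (f x * (f x + walk f x)))"
    unfolding N_def Q_def to_W using to_W[of f] by (simp add: power2_eq_square)
qed

section \<open>Square-summable functions through finite windows\<close>

text \<open>
  Written as \<open>L2_set\<close>, so that Minkowski's inequality comes from there. The norm of
  \<open>l2\<close> is the supremum of these seminorms, which makes every estimate on \<open>l2\<close> one on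
  finite sums.
\<close>
definition fnorm :: "'a set \<Rightarrow> ('a \<Rightarrow> complex) \<Rightarrow> real" where
  "fnorm F u = L2_set (\<lambda>x. sqrt (w x) * cmod (u x)) F"

lemma fnorm_nonneg: "0 \<le> fnorm F u"
  by (simp add: fnorm_def)

lemma fnorm_eq_sqrt:
  assumes "F \<subseteq> V"
  shows "fnorm F u = sqrt (\<Sum>x\<in>F. w x * (cmod (u x))\<^sup>2)"
proof -
  have "0 \<le> w x" if "x \<in> F" for x using that assms vertex_weight_nonneg by auto
  then show ?thesis unfolding fnorm_def L2_set_def
    by (intro arg_cong[where f=sqrt] sum.cong) (simp_all add: power_mult_distrib)
qed

lemma fnorm_square:
  assumes "F \<subseteq> V"
  shows "(fnorm F u)\<^sup>2 = (\<Sum>x\<in>F. w x * (cmod (u x))\<^sup>2)"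
  using assms vertex_weight_nonneg
  by (subst fnorm_eq_sqrt) (auto intro!: real_sqrt_pow2 sum_nonneg mult_nonneg_nonneg)

lemma fnorm_triangle:
  assumes "F \<subseteq> V"
  shows "fnorm F (\<lambda>x. u x + v x) \<le> fnorm F u + fnorm F v"
proof -
  have "fnorm F (\<lambda>x. u x + v x) \<le> L2_set (\<lambda>x. sqrt (w x) * cmod (u x) + sqrt (w x) * cmod (v x)) F"
    unfolding fnorm_def
    using assms vertex_weight_nonneg norm_triangle_ineq[of "u _" "v _"]
    by (intro L2_set_mono) (auto simp flip: distrib_left intro!: mult_left_mono)
  also have "\<dots> \<le> fnorm F u + fnorm F v"
    unfolding fnorm_def by (rule L2_set_triangle_ineq)
  finally show ?thesis .
qed

lemma fnorm_cmult: "fnorm F (\<lambda>x. c * u x) = cmod c * fnorm F u"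
  unfolding fnorm_def
  by (simp add: norm_mult L2_set_right_distrib mult.left_commute)

lemma fnorm_le_l2_norm:
  assumes "u \<in> l2 V \<mu>" "finite F" "F \<subseteq> V"
  shows "fnorm F u \<le> l2_norm V \<mu> u"
  unfolding l2_norm_def fnorm_eq_sqrt[OF assms(3)]
  using assms vertex_weight_nonneg
  by (intro real_sqrt_le_mono finite_sum_le_infsum) (auto simp: l2_def)

lemma l2I:
  assumes "\<And>x. x \<notin> V \<Longrightarrow> u x = 0" "0 \<le> C" "\<And>F. finite F \<Longrightarrow> F \<subseteq> V \<Longrightarrow> fnorm F u \<le> C"
  shows "u \<in> l2 V \<mu>" and "l2_norm V \<mu> u \<le> C"
proof -
  have bound: "(\<Sum>x\<in>F. w x * (cmod (u x))\<^sup>2) \<le> C\<^sup>2" if "finite F" "F \<subseteq> V" for F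
    using power_mono[OF assms(3)[OF that] fnorm_nonneg, of 2] fnorm_square[OF that(2)] by simp
  have "(\<lambda>x. w x * (cmod (u x))\<^sup>2) summable_on V"
  proof (rule nonneg_bdd_above_summable_on)
    show "bdd_above (sum (\<lambda>x. w x * (cmod (u x))\<^sup>2) ` {F. F \<subseteq> V \<and> finite F})"
      using bound by (intro bdd_aboveI[of _ "C\<^sup>2"]) auto
  qed (simp add: vertex_weight_nonneg)
  then show "u \<in> l2 V \<mu>" and "l2_norm V \<mu> u \<le> C"
    using assms(1,2) infsum_le_finite_sums[OF _ bound]
    by (auto simp: l2_def l2_norm_def intro!: real_le_lsqrt)
qed

lemma l2_norm_nonneg: "u \<in> l2 V \<mu> \<Longrightarrow> 0 \<le> l2_norm V \<mu> u"
  using fnorm_le_l2_norm[of u "{}"] by (simp add: fnorm_def)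

lemma l2_outside: "u \<in> l2 V \<mu> \<Longrightarrow> x \<notin> V \<Longrightarrow> u x = 0"
  by (simp add: l2_def)

lemma l2_cmod_le:
  assumes "u \<in> l2 V \<mu>"
  shows "sqrt (w x) * cmod (u x) \<le> l2_norm V \<mu> u"
proof (cases "x \<in> V")
  case True
  then show ?thesis
    using fnorm_le_l2_norm[OF assms, of "{x}"] vertex_weight_nonneg
    by (simp add: fnorm_def)
qed (use assms in \<open>simp add: l2_outside l2_norm_nonneg\<close>)

lemma l2_eq_0:
  assumes "u \<in> l2 V \<mu>" "l2_norm V \<mu> u \<le> 0"
  shows "u = (\<lambda>x. 0)"
proof
  fix x
  show "u x = 0"
  proof (cases "x \<in> V")
    case True
    have "sqrt (w x) * cmod (u x) \<le> 0" using l2_cmod_le[OF assms(1), of x] assms(2) by simp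
    then show ?thesis
      using vertex_weight_pos[OF True] by (simp add: mult_le_0_iff)
  qed (use assms in \<open>simp add: l2_outside\<close>)
qed

lemma l2_lincomb:
  assumes "u \<in> l2 V \<mu>" "v \<in> l2 V \<mu>"
  shows "(\<lambda>x. a * u x + b * v x) \<in> l2 V \<mu>"
    and "l2_norm V \<mu> (\<lambda>x. a * u x + b * v x) \<le> cmod a * l2_norm V \<mu> u + cmod b * l2_norm V \<mu> v"
proof -
  have "fnorm F (\<lambda>x. a * u x + b * v x) \<le> cmod a * l2_norm V \<mu> u + cmod b * l2_norm V \<mu> v"
    if "finite F" "F \<subseteq> V" for F
    using fnorm_triangle[OF that(2), of "\<lambda>x. a * u x" "\<lambda>x. b * v x"]
      mult_left_mono[OF fnorm_le_l2_norm[OF assms(1) that], of "cmod a"]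
      mult_left_mono[OF fnorm_le_l2_norm[OF assms(2) that], of "cmod b"]
    by (simp add: fnorm_cmult)
  from l2I[OF _ _ this] show "(\<lambda>x. a * u x + b * v x) \<in> l2 V \<mu>"
    and "l2_norm V \<mu> (\<lambda>x. a * u x + b * v x) \<le> cmod a * l2_norm V \<mu> u + cmod b * l2_norm V \<mu> v"
    using assms by (auto simp: l2_outside l2_norm_nonneg)
qed

lemma l2_finite_support:
  assumes "finite W" "W \<subseteq> V" "\<And>x. x \<notin> W \<Longrightarrow> u x = 0"
  shows "u \<in> l2 V \<mu>" and "l2_norm V \<mu> u = fnorm W u"
proof -
  have *: "fnorm F u \<le> fnorm W u" if "finite F" "F \<subseteq> V" for F
  proof -
    have "(\<Sum>x\<in>F. w x * (cmod (u x))\<^sup>2) \<le> (\<Sum>x\<in>F \<union> W. w x * (cmod (u x))\<^sup>2)"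
      using that assms vertex_weight_nonneg by (intro sum_mono2) (auto intro!: mult_nonneg_nonneg)
    also have "\<dots> = (\<Sum>x\<in>W. w x * (cmod (u x))\<^sup>2)"
      using that assms by (intro sum.mono_neutral_right) auto
    finally show ?thesis using that assms by (simp add: fnorm_eq_sqrt)
  qed
  have off: "u x = 0" if "x \<notin> V" for x using assms that by auto
  show "u \<in> l2 V \<mu>" using off fnorm_nonneg * by (rule l2I)
  moreover have "l2_norm V \<mu> u \<le> fnorm W u" using off fnorm_nonneg * by (rule l2I)
  ultimately show "l2_norm V \<mu> u = fnorm W u" using fnorm_le_l2_norm assms by (meson antisym)
qed

section \<open>The bottom of the signless form belongs to the spectrum\<close>

text \<open>
  Here b = B f with B = 1 + P - m, a form between 0 and 2. Nonnegativity of B at f - b/2 reads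
  0 \<le> \<langle>f, b\<rangle> - |b|^2 + \<langle>b, B b\<rangle> / 4, and \<langle>b, B b\<rangle> \<le> 2 |b|^2. This is
  Cauchy-Schwarz for the form B, with the optimal multiple of b written out.
\<close>
lemma residual_bound:
  fixes f :: "'a \<Rightarrow> real"
  assumes m: "signless_bound m" "0 \<le> m"
    and S: "finite S" "S \<subseteq> V" "\<And>x. x \<notin> S \<Longrightarrow> f x = 0"
  defines "W \<equiv> S \<union> E `` S"
  defines "b \<equiv> \<lambda>x. (1 - m) * f x + walk f x"
  shows "(\<Sum>x\<in>W. w x * (b x)\<^sup>2) \<le> 2 * (\<Sum>x\<in>W. w x * (f x * b x))"
    and "\<And>x. x \<notin> W \<Longrightarrow> b x = 0"
proof -
  have W: "finite W" "W \<subseteq> V" "S \<subseteq> W" "\<And>x. x \<notin> W \<Longrightarrow> f x = 0"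
    using S finite_Image_edges Image_edges_subset by (auto simp: W_def)
  show b0: "b x = 0" if "x \<notin> W" for x
  proof (cases "x \<in> V")
    case True
    have "\<mu> x y = 0" if "y \<in> S" for y
      using weight_outside_edges[of y x] weight_sym[of y x] True that S \<open>x \<notin> W\<close> by (auto simp: W_def)
    then have "w x *\<^sub>R walk f x = 0"
      using walk_supported[of x S f] True S by simp
    then show ?thesis using vertex_weight_pos[OF True] W(4)[OF that] by (simp add: b_def)
  qed (use S that in \<open>auto simp: b_def walk_outside\<close>)
  define d where "d = (\<lambda>x. (1 - m) * b x + walk b x)"
  have walk_sub: "walk (\<lambda>x. f x - b x / 2) x = walk f x - walk b x / 2" for x
    using walk_linear[of 1 f "- 1 / 2" b x] by simp
  have walk_f: "walk f x = b x - (1 - m) * f x" and walk_b: "walk b x = d x - (1 - m) * b x" for x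
    by (simp_all add: b_def d_def)
  have "m * (\<Sum>x\<in>W. w x * (f x - b x / 2)\<^sup>2)
      \<le> (\<Sum>x\<in>W. w x * ((f x - b x / 2) * (f x - b x / 2 + walk (\<lambda>x. f x - b x / 2) x)))"
    using W b0 by (intro m(1)[unfolded signless_bound_def, rule_format]) auto
  then have "0 \<le> (\<Sum>x\<in>W. w x * ((f x - b x / 2) * (b x - d x / 2)))"
  proof -
    have "(\<Sum>x\<in>W. w x * ((f x - b x / 2) * (b x - d x / 2))) =
        (\<Sum>x\<in>W. w x * ((f x - b x / 2) * (f x - b x / 2 + walk (\<lambda>x. f x - b x / 2) x)))
        - m * (\<Sum>x\<in>W. w x * (f x - b x / 2)\<^sup>2)"
      unfolding sum_distrib_left sum_subtractf[symmetric] walk_sub walk_f walk_b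
      by (intro sum.cong) (simp_all add: field_simps power2_eq_square)
    with \<open>m * _ \<le> _\<close> show ?thesis by simp
  qed
  also have "\<dots> = (\<Sum>x\<in>W. w x * (f x * b x)) - (\<Sum>x\<in>W. w x * (b x)\<^sup>2) / 2
      - (\<Sum>x\<in>W. w x * (f x * d x)) / 2 + (\<Sum>x\<in>W. w x * (b x * d x)) / 4"
    unfolding sum_divide_distrib sum_subtractf[symmetric] sum.distrib[symmetric]
    by (intro sum.cong) (simp_all add: field_simps power2_eq_square)
  also have "(\<Sum>x\<in>W. w x * (f x * d x)) = (\<Sum>x\<in>W. w x * (b x)\<^sup>2)"
  proof -
    have "(\<Sum>x\<in>W. w x * (f x * d x)) =
        (1 - m) * (\<Sum>x\<in>W. w x * (f x * b x)) + (\<Sum>x\<in>W. w x * (f x * walk b x))"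
      by (simp add: d_def sum_distrib_left algebra_simps flip: sum.distrib)
    also have "(\<Sum>x\<in>W. w x * (f x * walk b x)) = (\<Sum>x\<in>W. w x * (walk f x * b x))"
      using W b0 by (intro walk_symmetric) auto
    also have "(1 - m) * (\<Sum>x\<in>W. w x * (f x * b x)) + \<dots> = (\<Sum>x\<in>W. w x * (b x * b x))"
      unfolding sum_distrib_left sum.distrib[symmetric]
      by (intro sum.cong) (simp_all add: b_def algebra_simps)
    finally show ?thesis by (simp add: power2_eq_square)
  qed
  also have "(\<Sum>x\<in>W. w x * (b x * d x)) \<le> 2 * (\<Sum>x\<in>W. w x * (b x)\<^sup>2)"
  proof -
    have "(\<Sum>x\<in>W. w x * (b x * d x)) =
        (1 - m) * (\<Sum>x\<in>W. w x * (b x)\<^sup>2) + (\<Sum>x\<in>W. w x * (b x * walk b x))"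
      unfolding sum_distrib_left sum.distrib[symmetric]
      by (intro sum.cong) (simp_all add: d_def algebra_simps power2_eq_square)
    moreover have "(\<Sum>x\<in>W. w x * (b x * walk b x)) \<le> (\<Sum>x\<in>W. w x * (b x)\<^sup>2)"
      using abs_walk_form_le[of W b] W b0 by simp
    moreover have "0 \<le> m * (\<Sum>x\<in>W. w x * (b x)\<^sup>2)"
      using m W vertex_weight_nonneg by (auto intro!: mult_nonneg_nonneg sum_nonneg)
    ultimately show ?thesis by (simp add: left_diff_distrib)
  qed
  finally show "(\<Sum>x\<in>W. w x * (b x)\<^sup>2) \<le> 2 * (\<Sum>x\<in>W. w x * (f x * b x))" by simp
qed

lemma walk_of_real: "walk (\<lambda>x. complex_of_real (f x)) x = complex_of_real (walk f x)"
  by (simp add: walk_def scaleR_conv_of_real)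

text \<open>
  If 2 - m is a regular value of the Laplacian, with resolvent of norm at most C, then
  |f|^2 \<le> C^2 |B f|^2 \<le> 2 C^2 \<langle>f, B f\<rangle>. This is a gap of size 1 / (2 C^2) above m;
  the constant is taken slightly smaller to avoid a division by zero.
\<close>
lemma signless_bound_improve:
  assumes m: "signless_bound m" "0 \<le> m"
    and resolvent: "complex_of_real (2 - m) \<notin> l2_spectrum V \<mu> (laplacian V \<mu>)"
  obtains \<epsilon> where "0 < \<epsilon>" "signless_bound (m + \<epsilon>)"
proof -
  obtain R where R: "bounded_l2_operator V \<mu> R"
    and inv: "\<And>u. u \<in> l2 V \<mu> \<Longrightarrow>
      R (\<lambda>x. laplacian V \<mu> u x - complex_of_real (2 - m) * u x) = u"
    using resolvent unfolding l2_spectrum_def by blast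
  then obtain C where C: "\<And>u. u \<in> l2 V \<mu> \<Longrightarrow> l2_norm V \<mu> (R u) \<le> C * l2_norm V \<mu> u"
    unfolding bounded_l2_operator_def by blast
  define \<epsilon> where "\<epsilon> = 1 / (2 * C\<^sup>2 + 1)"
  have "0 < 2 * C\<^sup>2 + 1" using zero_le_power2[of C] by linarith
  then have \<epsilon>: "0 < \<epsilon>" by (simp add: \<epsilon>_def)
  have "signless_bound (m + \<epsilon>)"
    unfolding signless_bound_def
  proof (intro allI impI)
    fix S and f :: "'a \<Rightarrow> real"
    assume S: "finite S" "S \<subseteq> V" "\<forall>x. x \<notin> S \<longrightarrow> f x = 0"
    define W where "W = S \<union> E `` S"
    define b where "b = (\<lambda>x. (1 - m) * f x + walk f x)"
    have W: "finite W" "W \<subseteq> V" "S \<subseteq> W" "\<And>x. x \<notin> W \<Longrightarrow> f x = 0"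
      using S finite_Image_edges Image_edges_subset by (auto simp: W_def)
    have res: "(\<Sum>x\<in>W. w x * (b x)\<^sup>2) \<le> 2 * (\<Sum>x\<in>W. w x * (f x * b x))"
      and b0: "\<And>x. x \<notin> W \<Longrightarrow> b x = 0"
      using residual_bound[OF m S(1,2), of f] S(3) by (auto simp: W_def b_def)
    define u where "u = (\<lambda>x. complex_of_real (f x))"
    define v where "v = (\<lambda>x. complex_of_real (- b x))"
    have u: "u \<in> l2 V \<mu>" "l2_norm V \<mu> u = fnorm W u"
      using W by (auto intro!: l2_finite_support simp: u_def)
    have v: "v \<in> l2 V \<mu>" "l2_norm V \<mu> v = fnorm W v"
      using W b0 by (auto intro!: l2_finite_support simp: v_def)
    have "(\<lambda>x. laplacian V \<mu> u x - complex_of_real (2 - m) * u x) = v"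
    proof
      fix x
      have "laplacian V \<mu> u x = u x - complex_of_real (walk f x)"
        using l2_outside[OF u(1)] laplacian_eq_walk[of u x] by (simp add: u_def walk_of_real)
      then show "laplacian V \<mu> u x - complex_of_real (2 - m) * u x = v x"
        by (simp add: v_def u_def b_def algebra_simps)
    qed
    then have "R v = u" using inv[OF u(1)] by simp
    then have "fnorm W u \<le> C * fnorm W v" using C[OF v(1)] u v by simp
    then have "(fnorm W u)\<^sup>2 \<le> (C * fnorm W v)\<^sup>2" using fnorm_nonneg by (rule power_mono)
    then have "(\<Sum>x\<in>W. w x * (f x)\<^sup>2) \<le> C\<^sup>2 * (\<Sum>x\<in>W. w x * (b x)\<^sup>2)"
      using W by (simp add: power_mult_distrib fnorm_square u_def v_def)
    also have "\<dots> \<le> C\<^sup>2 * (2 * (\<Sum>x\<in>W. w x * (f x * b x)))"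
      using res by (intro mult_left_mono) auto
    also have "\<dots> \<le> (2 * C\<^sup>2 + 1) * (\<Sum>x\<in>W. w x * (f x * b x))"
    proof -
      have "0 \<le> (\<Sum>x\<in>W. w x * (b x)\<^sup>2)"
        using W vertex_weight_nonneg by (auto intro!: sum_nonneg mult_nonneg_nonneg)
      then have "0 \<le> (\<Sum>x\<in>W. w x * (f x * b x))" using res by linarith
      then show ?thesis by (simp add: algebra_simps)
    qed
    finally have "\<epsilon> * (\<Sum>x\<in>W. w x * (f x)\<^sup>2) \<le> (\<Sum>x\<in>W. w x * (f x * b x))"
      using \<open>0 < 2 * C\<^sup>2 + 1\<close> by (simp add: \<epsilon>_def field_simps)
    also have "\<dots> = (\<Sum>x\<in>W. w x * (f x * (f x + walk f x))) - m * (\<Sum>x\<in>W. w x * (f x)\<^sup>2)"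
      unfolding sum_distrib_left sum_subtractf[symmetric] b_def
      by (intro sum.cong) (simp_all add: algebra_simps power2_eq_square)
    finally have "(m + \<epsilon>) * (\<Sum>x\<in>W. w x * (f x)\<^sup>2) \<le> (\<Sum>x\<in>W. w x * (f x * (f x + walk f x)))"
      by (simp add: algebra_simps)
    moreover have "(\<Sum>x\<in>S. w x * (f x * g x)) = (\<Sum>x\<in>W. w x * (f x * g x))" for g
      using S W by (intro sum.mono_neutral_left) auto
    ultimately show "(m + \<epsilon>) * (\<Sum>x\<in>S. w x * (f x)\<^sup>2) \<le> (\<Sum>x\<in>S. w x * (f x * (f x + walk f x)))"
      by (simp add: power2_eq_square)
  qed
  with \<epsilon> show ?thesis by (rule that)
qed

section \<open>The resolvent above the spectrum\<close>

lemma walk_lincomb: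
  fixes u v :: "'a \<Rightarrow> complex"
  shows "walk (\<lambda>x. a * u x + b * v x) x = a * walk u x + b * walk v x"
  by (simp add: walk_def scaleR_conv_of_real distrib_left sum.distrib sum_distrib_left mult_ac)

text \<open>
  One step of the Richardson iteration for (s + P) u = 0. With s = t - 1 the operator s + P is
  t minus the Laplacian.
\<close>
definition relax :: "real \<Rightarrow> real \<Rightarrow> ('a \<Rightarrow> 'b::real_vector) \<Rightarrow> 'a \<Rightarrow> 'b" where
  "relax \<alpha> s u x = u x - \<alpha> *\<^sub>R (s *\<^sub>R u x + walk u x)"

text \<open>
  On functions supported in W the form s + P is at least \<delta>, and
  |(s + P) f|^2 \<le> (2 s^2 + 2) |f|^2 \<le> L |f|^2. The expansion |f|^2 - 2 \<alpha> \<langle>f, (s + P) f\<rangle> + \<alpha>^2 |(s + P) f|^2 is therefore at most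
  (1 - 2 \<alpha> \<delta> + \<alpha>^2 L) |f|^2, minimal at \<alpha> = \<delta> / L. The summand \<delta>^2 in L ensures that
  the resulting factor is nonnegative and has a square root.
\<close>
lemma relax_contraction_real:
  fixes f :: "'a \<Rightarrow> real"
  assumes c: "signless_bound c" and W: "finite W" "W \<subseteq> V" "\<And>x. x \<notin> W \<Longrightarrow> f x = 0"
    and F: "finite F" "F \<subseteq> V" and \<delta>: "0 < \<delta>" "\<delta> = s - 1 + c"
    and L: "L = 2 * s\<^sup>2 + 2 + \<delta>\<^sup>2"
  shows "(\<Sum>x\<in>F. w x * (relax (\<delta> / L) s f x)\<^sup>2) \<le> (1 - \<delta>\<^sup>2 / L) * (\<Sum>x\<in>W. w x * (f x)\<^sup>2)"
proof -
  define G where "G = F \<union> W"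
  define N where "N = (\<Sum>x\<in>W. w x * (f x)\<^sup>2)"
  define h where "h = (\<lambda>x. s * f x + walk f x)"
  define \<alpha> where "\<alpha> = \<delta> / L"
  have G: "finite G" "G \<subseteq> V" using F W by (auto simp: G_def)
  have wG: "0 \<le> w x" if "x \<in> G" for x using that G vertex_weight_nonneg by auto
  have "0 < L" unfolding L using \<delta> by (simp add: add_nonneg_pos)
  have "0 \<le> \<alpha>" using \<delta> \<open>0 < L\<close> by (simp add: \<alpha>_def)
  have to_W: "(\<Sum>x\<in>G. w x * (f x * g x)) = (\<Sum>x\<in>W. w x * (f x * g x))" for g
    using W F by (intro sum.mono_neutral_right) (auto simp: G_def)
  have "0 \<le> N" unfolding N_def using wG by (intro sum_nonneg mult_nonneg_nonneg) (auto simp: G_def)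
  have NG: "(\<Sum>x\<in>G. w x * (f x)\<^sup>2) = N"
    using to_W[of f] by (simp add: N_def power2_eq_square)
  have fh: "\<delta> * N \<le> (\<Sum>x\<in>G. w x * (f x * h x))"
  proof -
    have "(\<Sum>x\<in>G. w x * (f x * h x)) = (s - 1) * N + (\<Sum>x\<in>W. w x * (f x * (f x + walk f x)))"
      unfolding to_W N_def sum_distrib_left sum.distrib[symmetric]
      by (intro sum.cong) (simp_all add: h_def algebra_simps power2_eq_square)
    moreover have "c * N \<le> (\<Sum>x\<in>W. w x * (f x * (f x + walk f x)))"
      using c[unfolded signless_bound_def] W by (auto simp: N_def)
    ultimately show ?thesis by (simp add: \<delta> algebra_simps)
  qed
  have hh: "(\<Sum>x\<in>G. w x * (h x)\<^sup>2) \<le> L * N"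
  proof -
    have "(\<Sum>x\<in>G. w x * (h x)\<^sup>2) \<le> (\<Sum>x\<in>G. w x * (2 * s\<^sup>2 * (f x)\<^sup>2 + 2 * (walk f x)\<^sup>2))"
    proof (intro sum_mono mult_left_mono wG)
      fix x
      show "(h x)\<^sup>2 \<le> 2 * s\<^sup>2 * (f x)\<^sup>2 + 2 * (walk f x)\<^sup>2"
        using sum_squares_bound[of "s * f x" "walk f x"]
        by (simp add: h_def power2_sum power_mult_distrib)
    qed
    also have "\<dots> = 2 * s\<^sup>2 * N + 2 * (\<Sum>x\<in>G. w x * (walk f x)\<^sup>2)"
      unfolding NG[symmetric] sum_distrib_left sum.distrib[symmetric]
      by (intro sum.cong) (simp_all add: algebra_simps)
    also have "\<dots> \<le> 2 * s\<^sup>2 * N + 2 * N"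
      using walk_contraction_real[OF W G] by (simp add: N_def)
    also have "\<dots> \<le> L * N" using \<open>0 \<le> N\<close> by (simp add: L algebra_simps)
    finally show ?thesis .
  qed
  have "(\<Sum>x\<in>F. w x * (relax \<alpha> s f x)\<^sup>2) \<le> (\<Sum>x\<in>G. w x * (relax \<alpha> s f x)\<^sup>2)"
    using G wG by (intro sum_mono2) (auto simp: G_def)
  also have "\<dots> = N - 2 * \<alpha> * (\<Sum>x\<in>G. w x * (f x * h x)) + \<alpha>\<^sup>2 * (\<Sum>x\<in>G. w x * (h x)\<^sup>2)"
    unfolding NG[symmetric] sum_distrib_left sum.distrib[symmetric] sum_subtractf[symmetric]
    by (intro sum.cong) (simp_all add: relax_def h_def algebra_simps power2_eq_square)
  also have "\<dots> \<le> N - 2 * \<alpha> * (\<delta> * N) + \<alpha>\<^sup>2 * (L * N)"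
    using fh hh \<open>0 \<le> \<alpha>\<close> by (intro add_mono diff_mono mult_left_mono) auto
  also have "\<dots> = (1 - \<delta>\<^sup>2 / L) * N"
    using \<open>0 < L\<close> by (simp add: \<alpha>_def field_simps power2_eq_square)
  finally show ?thesis by (simp add: \<alpha>_def N_def)
qed

lemma Re_walk: "Re (walk u x) = walk (\<lambda>y. Re (u y)) x"
  and Im_walk: "Im (walk u x) = walk (\<lambda>y. Im (u y)) x"
  by (simp_all add: walk_def)

lemma relax_contraction_finite:
  assumes c: "signless_bound c" and W: "finite W" "W \<subseteq> V" "\<And>x. x \<notin> W \<Longrightarrow> u x = 0"
    and F: "finite F" "F \<subseteq> V" and \<delta>: "0 < \<delta>" "\<delta> = s - 1 + c"
    and L: "L = 2 * s\<^sup>2 + 2 + \<delta>\<^sup>2"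
  shows "fnorm F (relax (\<delta> / L) s u) \<le> sqrt (1 - \<delta>\<^sup>2 / L) * fnorm W u"
proof -
  have split: "(\<Sum>x\<in>A. w x * (cmod (v x))\<^sup>2)
      = (\<Sum>x\<in>A. w x * (Re (v x))\<^sup>2) + (\<Sum>x\<in>A. w x * (Im (v x))\<^sup>2)" for A and v :: "'a \<Rightarrow> complex"
    by (simp add: cmod_power2 distrib_left sum.distrib)
  have "Re (relax (\<delta> / L) s u x) = relax (\<delta> / L) s (\<lambda>y. Re (u y)) x"
    "Im (relax (\<delta> / L) s u x) = relax (\<delta> / L) s (\<lambda>y. Im (u y)) x" for x
    by (simp_all add: relax_def Re_walk Im_walk)
  then have "(\<Sum>x\<in>F. w x * (cmod (relax (\<delta> / L) s u x))\<^sup>2)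
      \<le> (1 - \<delta>\<^sup>2 / L) * (\<Sum>x\<in>W. w x * (cmod (u x))\<^sup>2)"
    unfolding split
    using relax_contraction_real[OF c W(1,2) _ F \<delta> L, of "\<lambda>y. Re (u y)"]
      relax_contraction_real[OF c W(1,2) _ F \<delta> L, of "\<lambda>y. Im (u y)"] W(3)
    by (simp add: distrib_left)
  then show ?thesis
    using F W by (simp add: fnorm_eq_sqrt flip: real_sqrt_mult)
qed

text \<open>
  The values on F only depend on the values on F and its neighbours, so the function may be cut off
  outside that finite set.
\<close>
lemma relax_contraction:
  assumes c: "signless_bound c" and u: "u \<in> l2 V \<mu>"
    and \<delta>: "0 < \<delta>" "\<delta> = s - 1 + c" and L: "L = 2 * s\<^sup>2 + 2 + \<delta>\<^sup>2"
  shows "relax (\<delta> / L) s u \<in> l2 V \<mu>"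
    and "l2_norm V \<mu> (relax (\<delta> / L) s u) \<le> sqrt (1 - \<delta>\<^sup>2 / L) * l2_norm V \<mu> u"
proof -
  have "0 \<le> 1 - \<delta>\<^sup>2 / L"
    using \<delta> by (simp add: L divide_le_eq add_nonneg_pos)
  then have q: "0 \<le> sqrt (1 - \<delta>\<^sup>2 / L)" by simp
  have *: "fnorm F (relax (\<delta> / L) s u) \<le> sqrt (1 - \<delta>\<^sup>2 / L) * l2_norm V \<mu> u"
    if F: "finite F" "F \<subseteq> V" for F
  proof -
    define W where "W = F \<union> E `` F"
    define u' where "u' x = (if x \<in> W then u x else 0)" for x
    have W: "finite W" "W \<subseteq> V"
      using F finite_Image_edges Image_edges_subset by (auto simp: W_def)
    have "relax (\<delta> / L) s u x = relax (\<delta> / L) s u' x" if "x \<in> F" for x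
    proof -
      have "walk u x = walk u' x"
        unfolding walk_def u'_def using that
        by (intro arg_cong2[where f="(*\<^sub>R)"] sum.cong) (auto simp: W_def)
      then show ?thesis using that by (simp add: relax_def u'_def W_def)
    qed
    then have "fnorm F (relax (\<delta> / L) s u) = fnorm F (relax (\<delta> / L) s u')"
      unfolding fnorm_def by (intro L2_set_cong) auto
    also have "\<dots> \<le> sqrt (1 - \<delta>\<^sup>2 / L) * fnorm W u'"
      using W F by (intro relax_contraction_finite[OF c _ _ _ _ _ \<delta> L]) (auto simp: u'_def)
    also have "fnorm W u' = fnorm W u"
      unfolding fnorm_def by (intro L2_set_cong) (auto simp: u'_def)
    also have "sqrt (1 - \<delta>\<^sup>2 / L) * fnorm W u \<le> sqrt (1 - \<delta>\<^sup>2 / L) * l2_norm V \<mu> u"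
      using fnorm_le_l2_norm[OF u W] q by (rule mult_left_mono)
    finally show ?thesis .
  qed
  have "relax (\<delta> / L) s u x = 0" if "x \<notin> V" for x
    using that by (simp add: relax_def l2_outside[OF u] walk_outside)
  moreover have "0 \<le> sqrt (1 - \<delta>\<^sup>2 / L) * l2_norm V \<mu> u"
    using q l2_norm_nonneg[OF u] by simp
  ultimately show "relax (\<delta> / L) s u \<in> l2 V \<mu>"
    and "l2_norm V \<mu> (relax (\<delta> / L) s u) \<le> sqrt (1 - \<delta>\<^sup>2 / L) * l2_norm V \<mu> u"
    using l2I[OF _ _ *] by auto
qed

text \<open>
  The iterates decay geometrically in norm, hence at each vertex, so the series is summed pointwise.
  Partial sums are bounded in every finite window uniformly in the window, which places the limit in
  \<open>l2\<close>. The relaxation passes through the series because its value at a vertex is a finite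
  combination.
\<close>
lemma neumann_series:
  assumes T: "\<And>u. u \<in> l2 V \<mu> \<Longrightarrow> relax \<alpha> s u \<in> l2 V \<mu>"
    "\<And>u. u \<in> l2 V \<mu> \<Longrightarrow> l2_norm V \<mu> (relax \<alpha> s u) \<le> q * l2_norm V \<mu> u"
    and q: "0 \<le> q" "q < 1" and g: "g \<in> l2 V \<mu>"
  obtains u where "u \<in> l2 V \<mu>" "\<And>x. u x = relax \<alpha> s u x + g x"
    "l2_norm V \<mu> u \<le> l2_norm V \<mu> g / (1 - q)"
proof -
  define k where "k n = (relax \<alpha> s ^^ n) g" for n
  define B where "B = l2_norm V \<mu> g"
  have k_Suc: "k (Suc n) = relax \<alpha> s (k n)" for n by (simp add: k_def)
  have k: "k n \<in> l2 V \<mu>" for n by (induction n) (simp_all add: k_def g T)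
  have kn: "l2_norm V \<mu> (k n) \<le> q ^ n * B" for n
  proof (induction n)
    case (Suc n)
    have "l2_norm V \<mu> (k (Suc n)) \<le> q * l2_norm V \<mu> (k n)" using T(2) k k_Suc by simp
    also have "\<dots> \<le> q * (q ^ n * B)" using Suc q by (intro mult_left_mono)
    finally show ?case by simp
  qed (simp add: k_def B_def)
  have geometric: "summable (\<lambda>n. q ^ n * a)" for a
    using q by (intro summable_mult2 summable_geometric) simp
  have summable: "summable (\<lambda>n. k n x)" for x
  proof (cases "x \<in> V")
    case True
    show ?thesis
    proof (rule summable_comparison_test'[OF geometric])
      fix n :: nat
      have "sqrt (w x) * cmod (k n x) \<le> q ^ n * B"
        using l2_cmod_le[OF k] kn by (rule order_trans)
      then show "norm (k n x) \<le> q ^ n * (B / sqrt (w x))"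
        using vertex_weight_pos[OF True] by (simp add: field_simps)
    qed
  next
    case False
    then show ?thesis using l2_outside[OF k] by simp
  qed
  define u where "u x = (\<Sum>n. k n x)" for x
  have sums: "(\<lambda>n. k n x) sums u x" for x
    using summable by (simp add: u_def summable_sums)
  have "fnorm F u \<le> B / (1 - q)" if F: "finite F" "F \<subseteq> V" for F
  proof (rule LIMSEQ_le_const2)
    have "(\<lambda>N. sqrt (\<Sum>x\<in>F. w x * (cmod (\<Sum>n<N. k n x))\<^sup>2))
        \<longlonglongrightarrow> sqrt (\<Sum>x\<in>F. w x * (cmod (u x))\<^sup>2)"
      using sums unfolding sums_def by (intro tendsto_intros)
    then show "(\<lambda>N. fnorm F (\<lambda>x. \<Sum>n<N. k n x)) \<longlonglongrightarrow> fnorm F u"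
      using F by (simp add: fnorm_eq_sqrt)
    have "fnorm F (\<lambda>x. \<Sum>n<N. k n x) \<le> (\<Sum>n<N. q ^ n * B)" for N
    proof (induction N)
      case (Suc N)
      have "fnorm F (\<lambda>x. (\<Sum>n<N. k n x) + k N x) \<le> fnorm F (\<lambda>x. \<Sum>n<N. k n x) + fnorm F (k N)"
        using F(2) by (rule fnorm_triangle)
      also have "fnorm F (k N) \<le> q ^ N * B"
        using fnorm_le_l2_norm[OF k F] kn by (rule order_trans)
      finally show ?case using Suc by simp
    qed (simp add: fnorm_def L2_set_def)
    also have "(\<Sum>n<N. q ^ n * B) \<le> (\<Sum>n. q ^ n * B)" for N
      using q l2_norm_nonneg[OF g] by (intro sum_le_suminf geometric) (auto simp: B_def)
    also have "(\<Sum>n. q ^ n * B) = B / (1 - q)"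
      using q by (subst suminf_mult2[symmetric]) (simp_all add: suminf_geometric summable_geometric)
    finally show "\<exists>N0. \<forall>N\<ge>N0. fnorm F (\<lambda>x. \<Sum>n<N. k n x) \<le> B / (1 - q)" by blast
  qed
  moreover have "u x = 0" if "x \<notin> V" for x
    using that l2_outside[OF k] by (simp add: u_def)
  moreover have "0 \<le> B / (1 - q)" using q l2_norm_nonneg[OF g] by (simp add: B_def)
  ultimately have "u \<in> l2 V \<mu>" "l2_norm V \<mu> u \<le> B / (1 - q)" using l2I[of u "B / (1 - q)"] by auto
  moreover have "u x = relax \<alpha> s u x + g x" for x
  proof -
    have "(\<lambda>n. walk (k n) x) sums walk u x"
      unfolding walk_def by (intro sums_scaleR_right sums_sum sums)
    then have "(\<lambda>n. relax \<alpha> s (k n) x) sums relax \<alpha> s u x"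
      unfolding relax_def by (intro sums_diff sums_scaleR_right sums_add sums)
    then have "(\<lambda>n. k (Suc n) x) sums relax \<alpha> s u x" by (simp add: k_Suc)
    moreover have "(\<lambda>n. k (Suc n) x) sums (u x - g x)"
      using sums[of x] by (subst sums_Suc_iff) (simp add: k_def)
    ultimately show ?thesis by (metis diff_add_cancel sums_unique2)
  qed
  ultimately show ?thesis using that by (simp add: B_def)
qed

lemma spectrum_upper_bound:
  assumes c: "signless_bound c" and t: "2 - c < t"
  shows "complex_of_real t \<notin> l2_spectrum V \<mu> (laplacian V \<mu>)"
proof -
  define s where "s = t - 1"
  define \<delta> where "\<delta> = s - 1 + c"
  define L where "L = 2 * s\<^sup>2 + 2 + \<delta>\<^sup>2"
  define \<alpha> where "\<alpha> = \<delta> / L"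
  define q where "q = sqrt (1 - \<delta>\<^sup>2 / L)"
  have \<delta>: "0 < \<delta>" using t by (simp add: \<delta>_def s_def)
  then have L: "0 < L" unfolding L_def by (simp add: add_nonneg_pos)
  have \<alpha>: "0 < \<alpha>" using \<delta> L by (simp add: \<alpha>_def)
  have "\<delta>\<^sup>2 \<le> L" by (simp add: L_def)
  then have q: "0 \<le> q" "q < 1" using \<delta> L by (simp_all add: q_def)
  have T: "relax \<alpha> s u \<in> l2 V \<mu>" "l2_norm V \<mu> (relax \<alpha> s u) \<le> q * l2_norm V \<mu> u"
    if "u \<in> l2 V \<mu>" for u
    using relax_contraction[OF c that \<delta> \<delta>_def L_def] by (simp_all add: \<alpha>_def q_def)
  have solve: "\<exists>u\<in>l2 V \<mu>. (\<forall>x. s *\<^sub>R u x + walk u x = - f x) \<and>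
      l2_norm V \<mu> u \<le> \<alpha> / (1 - q) * l2_norm V \<mu> f" if f: "f \<in> l2 V \<mu>" for f
  proof -
    define g where "g = (\<lambda>x. complex_of_real (- \<alpha>) * f x + 0 * f x)"
    have g: "g \<in> l2 V \<mu>" "l2_norm V \<mu> g \<le> \<alpha> * l2_norm V \<mu> f"
      using l2_lincomb[OF f f, of "complex_of_real (- \<alpha>)" 0] \<alpha> by (simp_all add: g_def)
    obtain u where u: "u \<in> l2 V \<mu>" "\<And>x. u x = relax \<alpha> s u x + g x"
      "l2_norm V \<mu> u \<le> l2_norm V \<mu> g / (1 - q)"
      using neumann_series[OF T q g(1)] by blast
    have "s *\<^sub>R u x + walk u x = - f x" for x
    proof -
      have "\<alpha> *\<^sub>R (s *\<^sub>R u x + walk u x + f x) = 0"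
        using u(2)[of x] by (simp add: relax_def g_def scaleR_conv_of_real algebra_simps)
      then show ?thesis using \<alpha> by (simp add: eq_neg_iff_add_eq_0)
    qed
    moreover have "l2_norm V \<mu> g / (1 - q) \<le> \<alpha> / (1 - q) * l2_norm V \<mu> f"
      using divide_right_mono[OF g(2), of "1 - q"] q by simp
    ultimately show ?thesis using u by (meson order_trans)
  qed
  have unique: "u = v" if u: "u \<in> l2 V \<mu>" and v: "v \<in> l2 V \<mu>"
    and eq: "\<And>x. s *\<^sub>R u x + walk u x = s *\<^sub>R v x + walk v x" for u v
  proof -
    define d where "d = (\<lambda>x. 1 * u x + (- 1) * v x)"
    have d: "d \<in> l2 V \<mu>" unfolding d_def using u v by (rule l2_lincomb)
    have "s *\<^sub>R d x + walk d x = 0" for x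
      using eq[of x] unfolding d_def walk_lincomb by (simp add: algebra_simps)
    then have "relax \<alpha> s d = d" by (simp add: relax_def fun_eq_iff)
    then have "l2_norm V \<mu> d \<le> q * l2_norm V \<mu> d" using T(2)[OF d] by simp
    then have "l2_norm V \<mu> d * (1 - q) \<le> 0" by (simp add: algebra_simps)
    then have "l2_norm V \<mu> d \<le> 0" using q by (simp add: mult_le_0_iff)
    then have "d = (\<lambda>x. 0)" using d by (intro l2_eq_0)
    then show ?thesis by (simp add: d_def fun_eq_iff)
  qed
  define R where "R f = (SOME u. u \<in> l2 V \<mu> \<and> (\<forall>x. s *\<^sub>R u x + walk u x = - f x) \<and>
      l2_norm V \<mu> u \<le> \<alpha> / (1 - q) * l2_norm V \<mu> f)" for f
  have R: "R f \<in> l2 V \<mu>" "s *\<^sub>R R f x + walk (R f) x = - f x"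
    "l2_norm V \<mu> (R f) \<le> \<alpha> / (1 - q) * l2_norm V \<mu> f" if "f \<in> l2 V \<mu>" for f x
    using someI_ex[OF solve[OF that, unfolded Bex_def]] by (auto simp: R_def)
  have R_lincomb: "R (\<lambda>x. a * f x + b * g x) = (\<lambda>x. a * R f x + b * R g x)"
    if f: "f \<in> l2 V \<mu>" and g: "g \<in> l2 V \<mu>" for a b f g
  proof (rule unique)
    show "R (\<lambda>x. a * f x + b * g x) \<in> l2 V \<mu>" using f g by (intro R l2_lincomb)
    show "(\<lambda>x. a * R f x + b * R g x) \<in> l2 V \<mu>" using f g by (intro R l2_lincomb)
    fix x
    have "s *\<^sub>R (a * R f x + b * R g x) + walk (\<lambda>x. a * R f x + b * R g x) x =
        a * (s *\<^sub>R R f x + walk (R f) x) + b * (s *\<^sub>R R g x + walk (R g) x)"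
      by (simp add: walk_lincomb algebra_simps)
    also have "\<dots> = - (a * f x + b * g x)" using f g by (simp add: R(2))
    finally show "s *\<^sub>R R (\<lambda>x. a * f x + b * g x) x + walk (R (\<lambda>x. a * f x + b * g x)) x =
        s *\<^sub>R (a * R f x + b * R g x) + walk (\<lambda>x. a * R f x + b * R g x) x"
      using R(2)[OF l2_lincomb(1)[OF f g]] by simp
  qed
  have shifted: "laplacian V \<mu> u x - complex_of_real t * u x = - (s *\<^sub>R u x + walk u x)"
    if "u \<in> l2 V \<mu>" for u x
    using l2_outside[OF that] by (simp add: laplacian_eq_walk s_def scaleR_conv_of_real algebra_simps)
  have "bounded_l2_operator V \<mu> R"
    unfolding bounded_l2_operator_def
  proof (intro conjI ballI allI)
    fix f g assume "f \<in> l2 V \<mu>" "g \<in> l2 V \<mu>"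
    then show "R (\<lambda>x. f x + g x) = (\<lambda>x. R f x + R g x)"
      using R_lincomb[of f g 1 1] by simp
  next
    fix a f assume "f \<in> l2 V \<mu>"
    then show "R (\<lambda>x. a * f x) = (\<lambda>x. a * R f x)"
      using R_lincomb[of f f a 0] by simp
  qed (use R(1,3) in blast)+
  moreover have "R (\<lambda>x. laplacian V \<mu> f x - complex_of_real t * f x) = f" if f: "f \<in> l2 V \<mu>" for f
  proof (rule unique)
    let ?h = "\<lambda>x. laplacian V \<mu> f x - complex_of_real t * f x"
    have "?h = (\<lambda>x. complex_of_real (1 / \<alpha>) * relax \<alpha> s f x + complex_of_real (- 1 / \<alpha>) * f x)"
      using \<alpha> by (auto simp: shifted[OF f] relax_def scaleR_conv_of_real field_simps)
    then have h: "?h \<in> l2 V \<mu>" by (simp only: l2_lincomb[OF T(1)[OF f] f])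
    then show "R ?h \<in> l2 V \<mu>" by (rule R)
    show "s *\<^sub>R R ?h x + walk (R ?h) x = s *\<^sub>R f x + walk f x" for x
      using R(2)[OF h, of x] shifted[OF f, of x] by simp
  qed (use f in simp)
  moreover have "(\<lambda>x. laplacian V \<mu> (R f) x - complex_of_real t * R f x) = f" if "f \<in> l2 V \<mu>" for f
    using R[OF that] by (simp add: shifted)
  ultimately show ?thesis unfolding l2_spectrum_def by blast
qed

section \<open>The top of the spectrum\<close>

lemma lambda_bar_eq:
  obtains m where "0 \<le> m" "signless_bound m" "lambda_bar V \<mu> = 2 - m"
    "\<And>c. signless_bound c \<Longrightarrow> c \<le> m"
proof -
  define m where "m = Sup {c. signless_bound c}"
  have bdd: "bdd_above {c. signless_bound c}"
    using signless_bound_le_2 by (auto intro: bdd_aboveI[of _ 2])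
  have upper: "c \<le> m" if "signless_bound c" for c
    unfolding m_def using that bdd by (intro cSup_upper) auto
  have "0 \<le> m" using upper signless_bound_0 by blast
  have m: "signless_bound m"
    unfolding signless_bound_def
  proof (intro allI impI)
    fix W and f :: "'a \<Rightarrow> real"
    assume W: "finite W" "W \<subseteq> V" "\<forall>x. x \<notin> W \<longrightarrow> f x = 0"
    define N where "N = (\<Sum>x\<in>W. w x * (f x)\<^sup>2)"
    define Q where "Q = (\<Sum>x\<in>W. w x * (f x * (f x + walk f x)))"
    have bound: "c * N \<le> Q" if "signless_bound c" for c
      using that[unfolded signless_bound_def] W by (auto simp: N_def Q_def)
    have "0 \<le> N"
      unfolding N_def using W vertex_weight_nonneg by (auto intro!: sum_nonneg mult_nonneg_nonneg)
    show "m * N \<le> Q"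
    proof (cases "N = 0")
      case True
      then show ?thesis using bound[OF signless_bound_0] by simp
    next
      case False
      then have "0 < N" using \<open>0 \<le> N\<close> by simp
      then have "m \<le> Q / N"
        unfolding m_def using bound signless_bound_0
        by (intro cSup_least) (auto simp: le_divide_eq)
      then show ?thesis using \<open>0 < N\<close> by (simp add: le_divide_eq)
    qed
  qed
  have "complex_of_real (2 - m) \<in> l2_spectrum V \<mu> (laplacian V \<mu>)"
  proof (rule ccontr)
    assume "\<not> ?thesis"
    then obtain \<epsilon> where "0 < \<epsilon>" "signless_bound (m + \<epsilon>)"
      using signless_bound_improve[OF m \<open>0 \<le> m\<close>] by blast
    then show False using upper[of "m + \<epsilon>"] by simp
  qed
  then have "lambda_bar V \<mu> = 2 - m"
    unfolding lambda_bar_def using spectrum_upper_bound[OF m]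
    by (intro cSup_eq_maximum) (auto simp: not_less[symmetric])
  with \<open>0 \<le> m\<close> m show ?thesis using upper by (rule that)
qed

lemma dual_cheeger_less_1_iff: "dual_cheeger V \<mu> < 1 \<longleftrightarrow> lambda_bar V \<mu> < 2"
proof -
  obtain m where m: "0 \<le> m" "signless_bound m" "lambda_bar V \<mu> = 2 - m"
    "\<And>c. signless_bound c \<Longrightarrow> c \<le> m"
    using lambda_bar_eq by blast
  show ?thesis
  proof
    assume "dual_cheeger V \<mu> < 1"
    then have "signless_bound ((1 - dual_cheeger V \<mu>)\<^sup>2 / 2)"
      by (intro signless_bound_of_dual_cheeger) auto
    then have "(1 - dual_cheeger V \<mu>)\<^sup>2 / 2 \<le> m" by (rule m)
    moreover have "0 < (1 - dual_cheeger V \<mu>)\<^sup>2 / 2" using \<open>dual_cheeger V \<mu> < 1\<close> by simp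
    ultimately show "lambda_bar V \<mu> < 2" using m(3) by linarith
  next
    assume "lambda_bar V \<mu> < 2"
    then show "dual_cheeger V \<mu> < 1"
      using dual_cheeger_le_of_signless_bound[OF m(2)] m(3) by simp
  qed
qed

end

section \<open>Self-loops and rough isometries\<close>

lemma graph_dist_Un_Id:
  assumes "(x, y) \<in> E\<^sup>*"
  shows "graph_dist (E \<union> Id) x y = graph_dist E x y"
proof -
  obtain n where n: "(x, y) \<in> E ^^ n" using assms rtrancl_imp_relpow by blast
  have shorten: "\<exists>k\<le>n. (x, y) \<in> E ^^ k" if "(x, y) \<in> (E \<union> Id) ^^ n" for n y
    using that
  proof (induction n arbitrary: y)
    case (Suc n)
    then obtain z where z: "(x, z) \<in> (E \<union> Id) ^^ n" "(z, y) \<in> E \<union> Id" by auto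
    then obtain k where k: "k \<le> n" "(x, z) \<in> E ^^ k" using Suc.IH by blast
    show ?case
    proof (cases "z = y")
      case True
      then show ?thesis using k le_SucI by blast
    next
      case False
      then have "(x, y) \<in> E ^^ Suc k" using z k by auto
      then show ?thesis using k by (meson Suc_le_mono)
    qed
  qed simp
  have loops: "(x, y) \<in> (E \<union> Id) ^^ n" if "(x, y) \<in> E ^^ n" for n y
    using that by (induction n arbitrary: y) auto
  have "(LEAST n. (x, y) \<in> (E \<union> Id) ^^ n) = (LEAST n. (x, y) \<in> E ^^ n)"
  proof (rule antisym)
    show "(LEAST n. (x, y) \<in> (E \<union> Id) ^^ n) \<le> (LEAST n. (x, y) \<in> E ^^ n)"
      using loops[OF LeastI[of "\<lambda>n. (x, y) \<in> E ^^ n", OF n]] by (rule Least_le)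
    obtain k where "k \<le> (LEAST n. (x, y) \<in> (E \<union> Id) ^^ n)" "(x, y) \<in> E ^^ k"
      using shorten[OF LeastI[of "\<lambda>n. (x, y) \<in> (E \<union> Id) ^^ n", OF loops[OF n]]] by blast
    then show "(LEAST n. (x, y) \<in> E ^^ n) \<le> (LEAST n. (x, y) \<in> (E \<union> Id) ^^ n)"
      by (meson Least_le order_trans)
  qed
  then show ?thesis by (simp add: graph_dist_def)
qed

lemma graph_dist_self: "graph_dist E x x = 0"
  by (simp add: graph_dist_def)

lemma rough_isometric_graphs_Un_Id:
  assumes "\<And>x y. x \<in> V \<Longrightarrow> y \<in> V \<Longrightarrow> (x, y) \<in> E\<^sup>*"
  shows "rough_isometric_graphs V (E \<union> Id) V E"
proof -
  have "(INF x\<in>V. graph_dist E z x) \<le> 0" if "z \<in> V" for z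
  proof -
    have "(INF x\<in>V. graph_dist E z x) \<le> graph_dist E z z"
      using that by (intro cINF_lower bdd_belowI[of _ 0]) (auto simp: graph_dist_def)
    then show ?thesis by (simp add: graph_dist_self)
  qed
  then have "rough_isometry V (graph_dist (E \<union> Id)) V (graph_dist E) (\<lambda>x. x)"
    unfolding rough_isometry_def using assms
    by (intro conjI) (simp, rule exI[of _ 1], rule exI[of _ 0], simp add: graph_dist_Un_Id)
  then show ?thesis unfolding rough_isometric_graphs_def by blast
qed

section \<open>The half line with and without self-loops\<close>

text \<open>
  The half line on the natural numbers with unit weights and, for r > 0, an additional loop of
  weight r at every vertex.
\<close>
definition path_weight :: "real \<Rightarrow> nat \<Rightarrow> nat \<Rightarrow> real" where
  "path_weight r x y = (if y = Suc x \<or> x = Suc y then 1 else if x = y then r else 0)"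

definition path_edges :: "real \<Rightarrow> (nat \<times> nat) set" where
  "path_edges r = {(x, y). 0 < path_weight r x y}"

lemma path_connected: "(x, y) \<in> (path_edges r)\<^sup>*"
proof -
  have step: "(n, Suc n) \<in> path_edges r" "(Suc n, n) \<in> path_edges r" for n
    by (simp_all add: path_edges_def path_weight_def)
  have "(0, n) \<in> (path_edges r)\<^sup>*" for n
    by (induction n) (auto intro: rtrancl_into_rtrancl step)
  moreover have "(n, 0) \<in> (path_edges r)\<^sup>*" for n
    by (induction n) (auto intro: converse_rtrancl_into_rtrancl step)
  ultimately show ?thesis by (meson rtrancl_trans)
qed

lemma infinite_graph_path:
  assumes "0 \<le> r"
  shows "infinite_graph UNIV (path_edges r) (path_weight r)"
proof
  fix x :: nat
  have "{y. (x, y) \<in> path_edges r} \<subseteq> {x - 1, x, Suc x}"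
    by (auto simp: path_edges_def path_weight_def split: if_splits)
  then show "finite {y. (x, y) \<in> path_edges r}" by (rule finite_subset) simp
next
  fix x y :: nat
  show "(x, y) \<in> (path_edges r)\<^sup>*" by (rule path_connected)
qed (use assms in \<open>auto simp: path_edges_def path_weight_def\<close>)

lemma vertex_weight_path:
  assumes "0 \<le> r"
  shows "vertex_weight UNIV (path_weight r) x = r + (if x = 0 then 1 else 2)"
proof -
  have "vertex_weight UNIV (path_weight r) x = (\<Sum>y\<in>{x - 1, x, Suc x}. path_weight r x y)"
  proof (rule infinite_graph.vertex_weight_eq_sum[OF infinite_graph_path[OF assms]])
    show "path_edges r `` {x} \<subseteq> {x - 1, x, Suc x}"
      by (auto simp: path_edges_def path_weight_def split: if_splits)
  qed auto
  also have "\<dots> = r + (if x = 0 then 1 else 2)"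
    by (cases x) (auto simp: path_weight_def)
  finally show ?thesis .
qed

text \<open>
  Every vertex weight is at most 3, and its loop contributes 1, so at most two thirds of the volume
  of a set is available for edges to a disjoint set.
\<close>
lemma dual_cheeger_path_loops: "dual_cheeger UNIV (path_weight 1) \<le> 2 / 3"
proof -
  interpret infinite_graph UNIV "path_edges 1" "path_weight 1"
    by (rule infinite_graph_path) simp
  have half: "edge_weight (path_weight 1) U U' \<le> 2 / 3 * vol UNIV (path_weight 1) U"
    if "finite U" "finite U'" "U \<inter> U' = {}" for U U'
  proof -
    have "vol UNIV (path_weight 1) U \<le> (\<Sum>x\<in>U. 3)"
      unfolding vol_def by (intro sum_mono) (simp add: vertex_weight_path)
    also have "\<dots> = 3 * (\<Sum>x\<in>U. 1)" by simp
    also have "(\<Sum>x\<in>U. 1) \<le> edge_weight (path_weight 1) U U"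
      unfolding edge_weight_def
    proof (rule sum_mono)
      fix x assume "x \<in> U"
      then have "path_weight 1 x x \<le> (\<Sum>y\<in>U. path_weight 1 x y)"
        using that by (intro member_le_sum) (auto simp: path_weight_def)
      then show "1 \<le> (\<Sum>y\<in>U. path_weight 1 x y)" by (simp add: path_weight_def)
    qed
    finally show ?thesis using edge_weight_Un_le_vol[of U U U'] that by simp
  qed
  show ?thesis
  proof (rule dual_cheeger_least)
    fix V1 V2 :: "nat set"
    assume "finite V1" "finite V2" "V1 \<inter> V2 = {}"
    then show "2 * edge_weight (path_weight 1) V1 V2
        \<le> 2 / 3 * (vol UNIV (path_weight 1) V1 + vol UNIV (path_weight 1) V2)"
      using half[of V1 V2] half[of V2 V1] edge_weight_commute[of V1 V2] by (auto simp: Int_commute)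
  qed
qed

text \<open>
  The even and the odd numbers below 2n + 2 split the initial segment so that of its total volume
  4n + 3 only the last vertex's edge out of the segment is lost.
\<close>
lemma dual_cheeger_path: "dual_cheeger UNIV (path_weight 0) = 1"
proof -
  interpret infinite_graph UNIV "path_edges 0" "path_weight 0"
    by (rule infinite_graph_path) simp
  have lower: "1 - 1 / (4 * real n + 3) \<le> dual_cheeger UNIV (path_weight 0)" for n
  proof -
    define V1 :: "nat set" where "V1 = (\<lambda>k. 2 * k) ` {..n}"
    define V2 :: "nat set" where "V2 = (\<lambda>k. 2 * k + 1) ` {..n}"
    have double: "(\<Sum>k\<le>n. if k = 0 then 1 else 2) = 2 * real n + 1"
      by (induction n) auto
    have vol1: "vol UNIV (path_weight 0) V1 = 2 * real n + 1"
      unfolding vol_def V1_def by (subst sum.reindex) (auto simp: inj_on_def vertex_weight_path double)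
    have vol2: "vol UNIV (path_weight 0) V2 = 2 * real n + 2"
      unfolding vol_def V2_def by (subst sum.reindex) (auto simp: inj_on_def vertex_weight_path)
    have "(\<Sum>l\<le>n. path_weight 0 (2 * k) (2 * l + 1)) = (if k = 0 then 1 else 2)" if "k \<le> n" for k
    proof -
      have "(\<Sum>l\<le>n. path_weight 0 (2 * k) (2 * l + 1)) = (\<Sum>l\<in>{k - 1, k}. path_weight 0 (2 * k) (2 * l + 1))"
      proof (rule sum.mono_neutral_right)
        show "\<forall>l\<in>{..n} - {k - 1, k}. path_weight 0 (2 * k) (2 * l + 1) = 0"
          by (auto simp: path_weight_def)
      qed (use that in auto)
      also have "\<dots> = (if k = 0 then 1 else 2)"
        by (cases k) (auto simp: path_weight_def)
      finally show ?thesis .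
    qed
    then have "edge_weight (path_weight 0) V1 V2 = 2 * real n + 1"
      unfolding edge_weight_def V1_def V2_def
      by (simp add: sum.reindex inj_on_def double)
    then have "2 * edge_weight (path_weight 0) V1 V2 / (vol UNIV (path_weight 0) V1 + vol UNIV (path_weight 0) V2)
        = 1 - 1 / (4 * real n + 3)"
      by (simp add: vol1 vol2 field_simps)
    moreover have "V1 \<inter> V2 = {}" by (auto simp: V1_def V2_def) presburger
    ultimately show ?thesis
      using dual_cheeger_upper[of V1 V2] by (auto simp: V1_def V2_def)
  qed
  have "(\<lambda>n. 1 - 1 / (4 * real n + 3)) \<longlonglongrightarrow> 1" by real_asymp
  then have "1 \<le> dual_cheeger UNIV (path_weight 0)"
    using lower by (intro LIMSEQ_le_const2) auto
  moreover have "dual_cheeger UNIV (path_weight 0) \<le> 1"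
    using two_edge_weight_le_vol by (intro dual_cheeger_least) simp
  ultimately show ?thesis by simp
qed

theorem corollary8p3:
  "(\<forall>(V :: 'a set) E \<mu>. infinite_graph V E \<mu> \<longrightarrow>
       (dual_cheeger V \<mu> < 1 \<longleftrightarrow> lambda_bar V \<mu> < 2)) \<and>
   (\<exists>(V :: nat set) E \<mu> (V' :: nat set) E' \<mu>'.
       infinite_graph V E \<mu> \<and> infinite_graph V' E' \<mu>' \<and>
       rough_isometric_graphs V E V' E' \<and>
       dual_cheeger V \<mu> < 1 \<and> dual_cheeger V' \<mu>' = 1)"
proof (rule conjI, intro allI impI)
  fix V :: "'a set" and E \<mu>
  assume "infinite_graph V E \<mu>"
  then show "dual_cheeger V \<mu> < 1 \<longleftrightarrow> lambda_bar V \<mu> < 2"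
    by (rule infinite_graph.dual_cheeger_less_1_iff)
next
  have "path_edges 1 = path_edges 0 \<union> Id"
    by (auto simp: path_edges_def path_weight_def)
  then have "rough_isometric_graphs UNIV (path_edges 1) UNIV (path_edges 0)"
    using rough_isometric_graphs_Un_Id[of UNIV "path_edges 0"] path_connected by simp
  moreover have "dual_cheeger UNIV (path_weight 1) < 1"
    using dual_cheeger_path_loops by simp
  ultimately show "\<exists>(V :: nat set) E \<mu> (V' :: nat set) E' \<mu>'.
       infinite_graph V E \<mu> \<and> infinite_graph V' E' \<mu>' \<and>
       rough_isometric_graphs V E V' E' \<and>
       dual_cheeger V \<mu> < 1 \<and> dual_cheeger V' \<mu>' = 1"
    using infinite_graph_path[of 0] infinite_graph_path[of 1] dual_cheeger_path by force
qed

end
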